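(* Let $A$ be a closed densely defined symmetric operator with equal deficiency indices in a separable Hilbert space $\mathfrak H$, and let $\widetilde A$ be a proper extension of $A$. Then $\widetilde A$ is almost solvable if and only if it is transversal to some self-adjoint extension $\widetilde A_0=\widetilde A_0^*$ of $A$. In this case, for every boundary triplet $\{\mathcal H,\Gamma_0,\Gamma_1\}$ for $A^*$ with $\ker\Gamma_0=\operatorname{dom}(\widetilde A_0)$ there exists an operator $B\in[\mathcal H]$ such that $\operatorname{dom}(\widetilde A)=\{f\in\operatorname{dom}(A^* ):\Gamma_1f=B\Gamma_0f\}$.
   Context: $[\mathcal H]$ denotes the bounded everywhere defined linear operators on $\mathcal H$. An extension $\widetilde A$ of $A$ is proper if $A\subset\widetilde A\subset A^*$. A boundary triplet for $A^*$ is a triple $\{\mathcal H,\Gamma_0,\Gamma_1\}$, where $\mathcal H$ is a Hilbert space and $\Gamma_0,\Gamma_1:\operatorname{dom}(A^* )\to\mathcal H$ are linear maps such that (i) $(A^*f,g)_{\mathfrak H}-(f,A^*g)_{\mathfrak H}=(\Gamma_1f,\Gamma_0g)_{\mathcal H}-(\Gamma_0f,\Gamma_1g)_{\mathcal H}$ for all $f,g\in\operatorname{dom}(A^* )$, and (ii) $f\mapsto(\Gamma_1f,\Gamma_0f)$ maps $\operatorname{dom}(A^* )$ onto $\mathcal H\oplus\mathcal H$. A proper extension $\widetilde A$ is almost solvable if there exist a boundary triplet $\{\mathcal H,\Gamma_0,\Gamma_1\}$ for $A^*$ and $B\in[\mathcal H]$ with $\operatorname{dom}(\widetilde A)=\{f\in\operatorname{dom}(A^*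 ):\Gamma_1f=B\Gamma_0f\}$. Two proper extensions $\widetilde A_0,\widetilde A_1$ of $A$ are transversal if $\operatorname{dom}(\widetilde A_0)\cap\operatorname{dom}(\widetilde A_1)=\operatorname{dom}(A)$ and $\operatorname{dom}(\widetilde A_0)+\operatorname{dom}(\widetilde A_1)=\operatorname{dom}(A^* )$.
   Formalization: The proper extension Ã is assumed closed; without this, with infinite deficiency indices, an everywhere defined unbounded B gives a non-closed proper extension transversal to the self-adjoint extension with domain ker Γ₀ but not almost solvable. *)

theory Defs
  imports "HOL-Analysis.Analysis"
begin

section \<open>Complex Hilbert spaces\<close>

text \<open>
  The inner product is linear in its first argument. Its real part is the real inner product
  of class \<^class>\<open>real_inner\<close>, so that norm, topology and completeness are those of the library.
\<close>

class complex_inner = real_inner +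
  fixes scaleC :: "complex \<Rightarrow> 'a \<Rightarrow> 'a" (infixr \<open>*\<^sub>C\<close> 75)
    and cinner :: "'a \<Rightarrow> 'a \<Rightarrow> complex"
  assumes scaleC_add_right: "a *\<^sub>C (x + y) = a *\<^sub>C x + a *\<^sub>C y"
    and scaleC_add_left: "(a + b) *\<^sub>C x = a *\<^sub>C x + b *\<^sub>C x"
    and scaleC_scaleC: "a *\<^sub>C b *\<^sub>C x = (a * b) *\<^sub>C x"
    and scaleR_scaleC: "r *\<^sub>R x = complex_of_real r *\<^sub>C x"
    and cinner_add_left: "cinner (x + y) z = cinner x z + cinner y z"
    and cinner_scaleC_left: "cinner (a *\<^sub>C x) y = a * cinner x y"
    and cinner_commute: "cinner x y = cnj (cinner y x)"
    and inner_eq_Re_cinner: "inner x y = Re (cinner x y)"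

class chilbert_space = complex_inner + complete_space

lemma scaleC_one: "1 *\<^sub>C x = (x :: 'a::complex_inner)"
  using scaleR_scaleC[of 1 x] by simp

global_interpretation complex_vector:
  vector_space "scaleC :: complex \<Rightarrow> 'a \<Rightarrow> 'a::complex_inner"
  by unfold_locales
    (simp_all add: scaleC_add_right scaleC_add_left scaleC_scaleC scaleC_one)

instantiation complex :: chilbert_space
begin

definition scaleC_complex :: "complex \<Rightarrow> complex \<Rightarrow> complex"
  where "scaleC_complex a x = a * x"

definition cinner_complex :: "complex \<Rightarrow> complex \<Rightarrow> complex"
  where "cinner_complex x y = x * cnj y"

instance
  by standard
    (simp_all add: scaleC_complex_def cinner_complex_def inner_complex_def algebra_simps
      scaleR_conv_of_real)

end

instantiation prod :: (complex_inner, complex_inner) complex_inner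
begin

definition scaleC_prod :: "complex \<Rightarrow> 'a \<times> 'b \<Rightarrow> 'a \<times> 'b"
  where "scaleC_prod a p = (a *\<^sub>C fst p, a *\<^sub>C snd p)"

definition cinner_prod :: "'a \<times> 'b \<Rightarrow> 'a \<times> 'b \<Rightarrow> complex"
  where "cinner_prod p q = cinner (fst p) (fst q) + cinner (snd p) (snd q)"

instance
proof
  fix p q :: "'a \<times> 'b"
  show "cinner p q = cnj (cinner q p)"
    unfolding cinner_prod_def
    using cinner_commute[of "fst p" "fst q"] cinner_commute[of "snd p" "snd q"] by simp
qed (simp_all add: scaleC_prod_def cinner_prod_def inner_prod_def scaleC_add_right
      scaleC_add_left scaleC_scaleC scaleR_scaleC cinner_add_left cinner_scaleC_left
      inner_eq_Re_cinner algebra_simps prod_eq_iff)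

end

instance prod :: (chilbert_space, chilbert_space) chilbert_space ..

text \<open>
  The Hilbert dimension is the cardinality of an orthonormal basis; it does not depend on
  the basis.
\<close>

definition orthonormal_basis :: "'a::complex_inner set \<Rightarrow> 'a set \<Rightarrow> bool"
  where "orthonormal_basis V B \<longleftrightarrow>
    B \<subseteq> V \<and> (\<forall>x\<in>B. \<forall>y\<in>B. cinner x y = (if x = y then 1 else 0)) \<and>
    V \<subseteq> closure (complex_vector.span B)"

definition equal_hilbert_dim :: "'a::complex_inner set \<Rightarrow> 'b::complex_inner set \<Rightarrow> bool"
  where "equal_hilbert_dim V W \<longleftrightarrow>
    (\<exists>B C. orthonormal_basis V B \<and> orthonormal_basis W C \<and> B \<approx> C)"


section \<open>Unbounded operators\<close>

text \<open>
  An operator is identified with its graph, hence \<open>dom A\<close> is \<^term>\<open>Domain A\<close>, extension of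
  operators is inclusion and an operator is closed iff its graph is a closed set.
\<close>

type_synonym 'a operator = "('a \<times> 'a) set"

definition linear_operator :: "'a::complex_inner operator \<Rightarrow> bool"
  where "linear_operator A \<longleftrightarrow> complex_vector.subspace A \<and> single_valued A"

definition densely_defined :: "'a::complex_inner operator \<Rightarrow> bool"
  where "densely_defined A \<longleftrightarrow> closure (Domain A) = UNIV"

definition adjoint_op :: "'a::complex_inner operator \<Rightarrow> 'a operator"
  where "adjoint_op A = {(g, g'). \<forall>(f, f')\<in>A. cinner f' g = cinner f g'}"

definition symmetric_operator :: "'a::complex_inner operator \<Rightarrow> bool"
  where "symmetric_operator A \<longleftrightarrow> (\<forall>(f, f')\<in>A. \<forall>(g, g')\<in>A. cinner f' g = cinner f g')"

definition selfadjoint_operator :: "'a::complex_inner operator \<Rightarrow> bool"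
  where "selfadjoint_operator A \<longleftrightarrow> linear_operator A \<and> densely_defined A \<and> adjoint_op A = A"

text \<open>\<open>deficiency_space A z = ker (A\<^sup>* - z)\<close>\<close>

definition deficiency_space :: "'a::complex_inner operator \<Rightarrow> complex \<Rightarrow> 'a set"
  where "deficiency_space A z = {f. (f, z *\<^sub>C f) \<in> adjoint_op A}"

definition equal_deficiency_indices :: "'a::complex_inner operator \<Rightarrow> bool"
  where "equal_deficiency_indices A \<longleftrightarrow>
    equal_hilbert_dim (deficiency_space A \<i>) (deficiency_space A (- \<i>))"


section \<open>Proper extensions and boundary triplets\<close>

text \<open>
  Closedness is not part of the following definition. It has to be assumed separately wherever
  transversality is meant to yield a bounded \<open>B\<close>: an unbounded everywhere defined \<open>B\<close> gives a
  non-closed proper extension transversal to \<open>ker \<Gamma>\<^sub>0\<close>.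
\<close>

definition proper_extension :: "'a::complex_inner operator \<Rightarrow> 'a operator \<Rightarrow> bool"
  where "proper_extension A At \<longleftrightarrow> linear_operator At \<and> A \<subseteq> At \<and> At \<subseteq> adjoint_op A"

definition transversal :: "'a::complex_inner operator \<Rightarrow> 'a operator \<Rightarrow> 'a operator \<Rightarrow> bool"
  where "transversal A A\<^sub>0 A\<^sub>1 \<longleftrightarrow>
    proper_extension A A\<^sub>0 \<and> proper_extension A A\<^sub>1 \<and>
    Domain A\<^sub>0 \<inter> Domain A\<^sub>1 = Domain A \<and>
    {f + g |f g. f \<in> Domain A\<^sub>0 \<and> g \<in> Domain A\<^sub>1} = Domain (adjoint_op A)"

definition clinear_on :: "'a::complex_inner set \<Rightarrow> ('a \<Rightarrow> 'b::complex_inner) \<Rightarrow> bool"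
  where "clinear_on V T \<longleftrightarrow>
    (\<forall>x\<in>V. \<forall>y\<in>V. T (x + y) = T x + T y) \<and> (\<forall>a. \<forall>x\<in>V. T (a *\<^sub>C x) = a *\<^sub>C T x)"

definition bounded_operator_on :: "'a::complex_inner set \<Rightarrow> ('a \<Rightarrow> 'a) \<Rightarrow> bool"
  where "bounded_operator_on H B \<longleftrightarrow>
    B ` H \<subseteq> H \<and> clinear_on H B \<and> (\<exists>K. \<forall>h\<in>H. norm (B h) \<le> K * norm h)"

text \<open>
  The boundary space is a closed subspace \<open>H\<close> of a Hilbert space type, since a type cannot be
  quantified existentially. Only the values of \<open>\<Gamma>\<^sub>0\<close> and \<open>\<Gamma>\<^sub>1\<close> on \<open>dom A\<^sup>*\<close> matter.
\<close>

definition boundary_triplet ::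
    "'a::chilbert_space operator \<Rightarrow> 'k::chilbert_space set \<Rightarrow> ('a \<Rightarrow> 'k) \<Rightarrow> ('a \<Rightarrow> 'k) \<Rightarrow> bool"
  where "boundary_triplet A H \<Gamma>\<^sub>0 \<Gamma>\<^sub>1 \<longleftrightarrow>
    complex_vector.subspace H \<and> closed H \<and>
    clinear_on (Domain (adjoint_op A)) \<Gamma>\<^sub>0 \<and> clinear_on (Domain (adjoint_op A)) \<Gamma>\<^sub>1 \<and>
    (\<forall>(f, f')\<in>adjoint_op A. \<forall>(g, g')\<in>adjoint_op A.
      cinner f' g - cinner f g' = cinner (\<Gamma>\<^sub>1 f) (\<Gamma>\<^sub>0 g) - cinner (\<Gamma>\<^sub>0 f) (\<Gamma>\<^sub>1 g)) \<and>
    (\<lambda>f. (\<Gamma>\<^sub>1 f, \<Gamma>\<^sub>0 f)) ` Domain (adjoint_op A) = H \<times> H"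

text \<open>
  The type argument is the Hilbert space in which the boundary spaces live. The choice of the
  space of \<open>A\<close> itself is no restriction: \<open>H\<close> is always isometrically isomorphic to the
  deficiency subspaces of \<open>A\<close>.
\<close>

definition almost_solvable ::
    "'k::chilbert_space itself \<Rightarrow> 'a::chilbert_space operator \<Rightarrow> 'a operator \<Rightarrow> bool"
  where "almost_solvable TYPE('k) A At \<longleftrightarrow> proper_extension A At \<and>
    (\<exists>(H :: 'k set) \<Gamma>\<^sub>0 \<Gamma>\<^sub>1 B. boundary_triplet A H \<Gamma>\<^sub>0 \<Gamma>\<^sub>1 \<and> bounded_operator_on H B \<and>
      Domain At = {f \<in> Domain (adjoint_op A). \<Gamma>\<^sub>1 f = B (\<Gamma>\<^sub>0 f)})"

end

theory Submission
  imports Defs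
begin

text \<open>
  Given a triplet and a bounded \<open>B\<close>, the restriction of \<open>A\<^sup>*\<close> to \<open>ker \<Gamma>\<^sub>0\<close> is self-adjoint by Green's
  identity and surjectivity, and it is transversal to the extension \<open>\<Gamma>\<^sub>1 f = B \<Gamma>\<^sub>0 f\<close> since
  \<open>dom A = ker \<Gamma>\<^sub>0 \<inter> ker \<Gamma>\<^sub>1\<close>, a consequence of \<open>A\<^sup>*\<^sup>* = A\<close>. Conversely, transversality to
  \<open>ker \<Gamma>\<^sub>0\<close> says that \<open>\<Gamma>\<^sub>0\<close> maps \<open>dom At\<close> onto \<open>H\<close> and that \<open>\<Gamma>\<^sub>1\<close> factors through \<open>\<Gamma>\<^sub>0\<close> there, which
  defines \<open>B\<close>. It is bounded because both boundary maps are bounded in the graph norm and, \<open>At\<close>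
  being closed, \<open>\<Gamma>\<^sub>0\<close> has bounded lifts to the graph of \<open>At\<close> by the open mapping theorem. Finally, every
  self-adjoint extension is \<open>ker \<Gamma>\<^sub>0\<close> for a triplet on the deficiency space \<open>ker (A\<^sup>* - \<i>)\<close>.
\<close>


section \<open>Closed linear relations and orthogonal decompositions\<close>

text \<open>Baire category half of the open mapping theorem. The domain is the union of the sets
  \<open>V n\<close> of points with a partner of norm at most \<open>n\<close>, so the closure of
  some \<open>V n\<close> contains a relative ball. Symmetry and scaling turn this into a bound
  proportional to \<open>norm x\<close>. Only closures are controlled, hence the error
  \<open>e\<close>.\<close>

lemma approximate_bounded_selection:
  fixes R :: "('a::{real_normed_vector,complete_space} \<times> 'b::real_normed_vector) set"
  assumes R: "subspace R" and S: "closed (Domain R)"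
  obtains M where "\<And>x e. x \<in> Domain R \<Longrightarrow> e > 0 \<Longrightarrow>
    \<exists>(u, y)\<in>R. norm y \<le> M * norm x \<and> norm (x - u) < e"
proof -
  define S where "S = Domain R"
  define V where "V n = {x. \<exists>y. (x, y) \<in> R \<and> norm y \<le> real n}" for n
  have VS: "V n \<subseteq> S" for n
    by (auto simp: V_def S_def)
  have SV: "S = (\<Union>n. V n)"
    using real_arch_simple by (fastforce simp: V_def S_def)
  have S0: "0 \<in> S"
    using subspace_0[OF R] by (auto simp: S_def zero_prod_def)
  \<comment> \<open>Baire's theorem is applied inside \<open>S\<close>, which is complete as a
    closed set; interiors are therefore relative to \<open>S\<close>.\<close>
  have complete: "completely_metrizable_space (top_of_set S)"
    using S completely_metrizable_space_closedin[OF completely_metrizable_space_euclidean]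
    by (simp add: S_def)
  have clS: "closure (V n) \<subseteq> S" for n
    using VS S by (simp add: S_def closure_minimal)
  have "\<exists>n. top_of_set S interior_of (closure (V n)) \<noteq> {}"
  proof (rule ccontr)
    assume "\<not> ?thesis"
    then have "top_of_set S interior_of \<Union> (range (\<lambda>n. closure (V n))) = {}"
      using clS by (intro Baire_category_alt) (auto simp: complete closed_subset)
    moreover have "\<Union> (range (\<lambda>n. closure (V n))) = S"
      using clS SV closure_subset by blast
    ultimately show False
      using S0 by (metis empty_iff interior_of_topspace topspace_euclidean_subtopology)
  qed
  then obtain n x0 where "x0 \<in> top_of_set S interior_of (closure (V n))"
    by blast
  then obtain T where T: "openin (top_of_set S) T" "x0 \<in> T" "T \<subseteq> closure (V n)"
    unfolding interior_of_def by blast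
  then obtain r where r: "r > 0" "\<And>x. x \<in> S \<Longrightarrow> dist x x0 < r \<Longrightarrow> x \<in> T"
    unfolding openin_euclidean_subtopology_iff by blast
  have x0: "x0 \<in> S"
    using T clS by blast
  have subS: "subspace S"
    unfolding S_def using subspace_0[OF R] subspace_add[OF R] subspace_scale[OF R]
    by (intro subspaceI) (force simp: Domain_iff zero_prod_def)+
  \<comment> \<open>Moves the ball from \<open>x0\<close> to the origin: \<open>x\<close> is half
    the difference of \<open>x0 + x\<close> and \<open>x0 - x\<close>, and half the difference of
    their approximants keeps the bound \<open>n\<close>.\<close>
  have near: "\<exists>(u, y)\<in>R. norm y \<le> n \<and> norm (x - u) < e"
    if x: "x \<in> S" "norm x < r" and "e > 0" for x e
  proof -
    have "x0 + x \<in> closure (V n)" "x0 - x \<in> closure (V n)"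
      using x T r(2)[of "x0 + x"] r(2)[of "x0 - x"] x0 subspace_add[OF subS] subspace_diff[OF subS]
      by (auto simp: dist_norm)
    then obtain u v where uv: "u \<in> V n" "dist u (x0 + x) < e" "v \<in> V n" "dist v (x0 - x) < e"
      using \<open>e > 0\<close> unfolding closure_approachable by blast
    then obtain y z where yz: "(u, y) \<in> R" "norm y \<le> n" "(v, z) \<in> R" "norm z \<le> n"
      by (auto simp: V_def)
    have "((1/2) *\<^sub>R (u - v), (1/2) *\<^sub>R (y - z)) \<in> R"
      using subspace_scale[OF R subspace_diff[OF R yz(1,3)], of "1/2"] by simp
    moreover have "norm ((1/2) *\<^sub>R (y - z)) \<le> n"
      using norm_triangle_ineq4[of y z] yz by simp
    moreover have "norm (x - (1/2) *\<^sub>R (u - v)) < e"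
    proof -
      have "x - (1/2) *\<^sub>R (u - v) = (1/2) *\<^sub>R ((v - (x0 - x)) - (u - (x0 + x)))"
        by (simp add: algebra_simps flip: scaleR_left.add)
      then show ?thesis
        using norm_triangle_ineq4[of "v - (x0 - x)" "u - (x0 + x)"] uv
        by (simp add: dist_norm)
    qed
    ultimately show ?thesis
      by blast
  qed
  show ?thesis
  proof
    fix x and e :: real
    assume x: "x \<in> Domain R" and e: "e > 0"
    show "\<exists>(u, y)\<in>R. norm y \<le> 2 * n / r * norm x \<and> norm (x - u) < e"
    proof (cases "x = 0")
      case True
      then show ?thesis
        using subspace_0[OF R] e by (intro bexI[of _ 0]) (auto simp: zero_prod_def)
    next
      case False
      \<comment> \<open>Rescales \<open>x\<close> to norm \<open>r / 2\<close>, which lies inside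
        the ball; undoing the scaling produces the constant \<open>2 * n / r\<close>.\<close>
      define t where "t = r / (2 * norm x)"
      have t: "t > 0"
        using r False by (simp add: t_def)
      have "t *\<^sub>R x \<in> S" "norm (t *\<^sub>R x) < r" "t * e > 0"
        using x subspace_scale[OF subS] r False e t by (auto simp: S_def t_def)
      then obtain u y where uy: "(u, y) \<in> R" "norm y \<le> n" "norm (t *\<^sub>R x - u) < t * e"
        using near by blast
      have "(inverse t *\<^sub>R u, inverse t *\<^sub>R y) \<in> R"
        using subspace_scale[OF R uy(1), of "inverse t"] by simp
      moreover have "norm (inverse t *\<^sub>R y) \<le> 2 * n / r * norm x"
        using uy(2) r False t by (simp add: t_def field_simps)
      moreover have "norm (x - inverse t *\<^sub>R u) < e"
      proof -
        have "x - inverse t *\<^sub>R u = inverse t *\<^sub>R (t *\<^sub>R x - u)"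
          using t by (simp add: algebra_simps)
        then have "norm (x - inverse t *\<^sub>R u) = inverse t * norm (t *\<^sub>R x - u)"
          using t by simp
        also have "\<dots> < inverse t * (t * e)"
          using uy(3) t by (intro mult_strict_left_mono) auto
        finally show ?thesis
          using t by (simp flip: mult.assoc)
      qed
      ultimately show ?thesis
        by blast
    qed
  qed
qed

text \<open>
  The open mapping theorem for closed linear relations. It contains the closed graph theorem
  (single-valued \<open>R\<close>) and bounded lifting along a surjection (\<open>R\<close> an inverse graph).
\<close>

lemma bounded_selection:
  fixes R :: "('a::{real_normed_vector,complete_space} \<times> 'b::{real_normed_vector,complete_space}) set"
  assumes R: "subspace R" and clR: "closed R" and S: "closed (Domain R)"
  obtains K where "\<And>x. x \<in> Domain R \<Longrightarrow> \<exists>y. (x, y) \<in> R \<and> norm y \<le> K * norm x"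
proof -
  obtain M where M: "\<And>x e. x \<in> Domain R \<Longrightarrow> e > 0 \<Longrightarrow>
      \<exists>(u, y)\<in>R. norm y \<le> M * norm x \<and> norm (x - u) < e"
    using approximate_bounded_selection[OF R S] by blast
  \<comment> \<open>One correction step halves the residual. The case \<open>x = 0\<close> is
    separate because the admissible error must be positive.\<close>
  have "\<exists>p. p \<in> R \<and> norm (snd p) \<le> M * norm x \<and> norm (x - fst p) \<le> norm x / 2"
    if "x \<in> Domain R" for x
  proof (cases "x = 0")
    case True
    then show ?thesis
      using subspace_0[OF R] by (intro exI[of _ 0]) auto
  next
    case False
    then show ?thesis
      using M[OF that, of "norm x / 2"] by force
  qed
  then obtain p where p: "\<And>x. x \<in> Domain R \<Longrightarrow> p x \<in> R"
    "\<And>x. x \<in> Domain R \<Longrightarrow> norm (snd (p x)) \<le> M * norm x"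
    "\<And>x. x \<in> Domain R \<Longrightarrow> norm (x - fst (p x)) \<le> norm x / 2"
    by metis
  have subD: "subspace (Domain R)"
    using subspace_0[OF R] subspace_add[OF R] subspace_scale[OF R]
    by (intro subspaceI) (force simp: Domain_iff zero_prod_def)+
  show ?thesis
  proof
    fix x assume x: "x \<in> Domain R"
    \<comment> \<open>\<open>X k\<close> is what remains of \<open>x\<close> after \<open>k\<close>
      corrections; the partners of the corrections form a geometrically convergent series.\<close>
    define X where "X k = ((\<lambda>x. x - fst (p x)) ^^ k) x" for k
    have X_Suc: "X (Suc k) = X k - fst (p (X k))" and X_0: "X 0 = x" for k
      by (simp_all add: X_def)
    have XD: "X k \<in> Domain R" for k
    proof (induction k)
      case (Suc k)
      have "fst (p (X k)) \<in> Domain R"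
        using p(1)[OF Suc] by (metis DomainI prod.collapse)
      then show ?case
        using subspace_diff[OF subD Suc] by (simp add: X_Suc)
    qed (simp add: X_0 x)
    have Xn: "norm (X k) \<le> (1/2) ^ k * norm x" for k
    proof (induction k)
      case (Suc k)
      then show ?case
        using p(3)[OF XD[of k]] by (simp add: X_Suc)
    qed (simp add: X_0)
    define y where "y k = snd (p (X k))" for k
    have M0: "norm (y k) \<le> (1/2) ^ k * (\<bar>M\<bar> * norm x)" for k
    proof -
      have "norm (y k) \<le> M * norm (X k)"
        unfolding y_def by (rule p(2)[OF XD])
      also have "\<dots> \<le> \<bar>M\<bar> * norm (X k)"
        by (simp add: mult_right_mono)
      also have "\<dots> \<le> \<bar>M\<bar> * ((1/2) ^ k * norm x)"
        by (intro mult_left_mono Xn) auto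
      finally show ?thesis
        by (simp add: algebra_simps)
    qed
    define Y where "Y n = (\<Sum>k<n. y k)" for n
    have tail: "norm (Y n - Y m) \<le> 2 * (1/2) ^ m * (\<bar>M\<bar> * norm x)" if "m \<le> n" for m n
    proof -
      \<comment> \<open>The exact geometric sum is kept so that the induction closes; the subtracted
        term is dropped afterwards.\<close>
      have "norm (Y n - Y m) \<le> (2 * (1/2) ^ m - 2 * (1/2) ^ n) * (\<bar>M\<bar> * norm x)"
        using that
      proof (induction n rule: dec_induct)
        case (step n)
        have "norm (Y (Suc n) - Y m) \<le> norm (Y n - Y m) + norm (y n)"
          using norm_triangle_ineq[of "Y n - Y m" "y n"] by (simp add: Y_def algebra_simps)
        then show ?case
          using step.IH M0[of n] by (simp add: algebra_simps)
      qed simp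
      also have "\<dots> \<le> 2 * (1/2) ^ m * (\<bar>M\<bar> * norm x)"
        by (intro mult_right_mono) auto
      finally show ?thesis .
    qed
    have small: "(\<lambda>m. 2 * (1/2) ^ m * (\<bar>M\<bar> * norm x)) \<longlonglongrightarrow> 0"
      by (intro tendsto_mult_left_zero tendsto_mult_right_zero LIMSEQ_power_zero) simp
    have "Cauchy Y"
    proof (rule metric_CauchyI)
      fix e :: real assume "e > 0"
      then obtain N where N: "2 * (1/2) ^ N * (\<bar>M\<bar> * norm x) < e / 2"
        using order_tendstoD(2)[OF small, of "e / 2"] by (auto simp: eventually_sequentially)
      have "dist (Y m) (Y n) < e" if "m \<ge> N" "n \<ge> N" for m n
        using tail[OF that(1)] tail[OF that(2)] N dist_triangle_half_r[of "Y N" "Y m" e "Y n"]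
        by (simp add: dist_norm norm_minus_commute)
      then show "\<exists>N. \<forall>m\<ge>N. \<forall>n\<ge>N. dist (Y m) (Y n) < e"
        by blast
    qed
    then obtain z where z: "Y \<longlonglongrightarrow> z"
      using Cauchy_convergent convergent_def by blast
    \<comment> \<open>The corrections telescope to \<open>x - X n\<close>; closedness of
      \<open>R\<close> then lets \<open>n\<close> tend to infinity.\<close>
    have "(x - X n, Y n) \<in> R" for n
    proof (induction n)
      case 0
      then show ?case
        using subspace_0[OF R] by (simp add: X_0 Y_def zero_prod_def)
    next
      case (Suc n)
      show ?case
        using subspace_add[OF R Suc p(1)[OF XD[of n]]]
        by (simp add: X_Suc Y_def y_def plus_prod_def algebra_simps)
    qed
    moreover have "X \<longlonglongrightarrow> 0"
    proof (rule Lim_null_comparison[of _ "\<lambda>k. (1/2) ^ k * norm x"])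
      show "(\<lambda>k. (1/2) ^ k * norm x) \<longlonglongrightarrow> 0"
        by (intro tendsto_mult_left_zero LIMSEQ_power_zero) simp
    qed (simp add: Xn)
    then have "(\<lambda>n. (x - X n, Y n)) \<longlonglongrightarrow> (x - 0, z)"
      by (intro tendsto_intros z)
    ultimately have "(x, z) \<in> R"
      using closed_sequentially[OF clR] by (metis (no_types, lifting) diff_zero)
    moreover have "norm z \<le> 2 * \<bar>M\<bar> * norm x"
    proof (rule LIMSEQ_le_const2[OF tendsto_norm[OF z]])
      show "\<exists>N. \<forall>n\<ge>N. norm (Y n) \<le> 2 * \<bar>M\<bar> * norm x"
        using tail[of 0] by (simp add: Y_def mult.assoc)
    qed
    ultimately show "\<exists>y. (x, y) \<in> R \<and> norm y \<le> 2 * \<bar>M\<bar> * norm x"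
      by blast
  qed
qed

text \<open>Projection theorem: a minimizing sequence for the distance to \<open>S\<close> is Cauchy
  by the parallelogram law, and minimality of its limit forces orthogonality.\<close>

lemma orthogonal_decomposition:
  fixes S :: "'a::{real_inner,complete_space} set"
  assumes S: "subspace S" and clS: "closed S"
  obtains s where "s \<in> S" "\<And>t. t \<in> S \<Longrightarrow> inner (x - s) t = 0"
proof -
  define d where "d = infdist x S"
  have ne: "S \<noteq> {}"
    using subspace_0[OF S] by blast
  have dle: "d \<le> norm (x - s)" if "s \<in> S" for s
    using infdist_le[OF that, of x] by (simp add: d_def dist_norm)
  have d0: "d \<ge> 0"
    by (simp add: d_def infdist_nonneg)
  have "\<exists>s\<in>S. norm (x - s) < d + 1 / Suc n" for n
    using ne infdist_notempty[OF ne] cInf_lessD[of "dist x ` S" "d + 1 / Suc n"]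
    by (auto simp: d_def dist_norm)
  then obtain s where s: "\<And>n. s n \<in> S" "\<And>n. norm (x - s n) < d + 1 / Suc n"
    by metis
  \<comment> \<open>Parallelogram law, with the midpoint of \<open>a\<close> and \<open>b\<close> in
    \<open>S\<close> and hence at distance at least \<open>d\<close> from \<open>x\<close>.\<close>
  have gap: "(norm (a - b))\<^sup>2 \<le> 2 * (norm (x - a))\<^sup>2 + 2 * (norm (x - b))\<^sup>2 - 4 * d\<^sup>2"
    if "a \<in> S" "b \<in> S" for a b
  proof -
    have "(1/2) *\<^sub>R (a + b) \<in> S"
      using that S by (simp add: subspace_add subspace_scale)
    then have "d\<^sup>2 \<le> (norm (x - (1/2) *\<^sub>R (a + b)))\<^sup>2"
      using dle d0 by (simp add: power_mono)
    then show ?thesis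
      by (simp add: power2_norm_eq_inner inner_simps inner_commute field_simps)
  qed
  have lim: "(\<lambda>n. norm (x - s n)) \<longlonglongrightarrow> d"
  proof (rule tendsto_sandwich[of "\<lambda>_. d" _ _ "\<lambda>n. d + 1 / Suc n"])
    show "(\<lambda>n. d + 1 / real (Suc n)) \<longlonglongrightarrow> d"
      using tendsto_add[OF tendsto_const lim_inverse_n', THEN LIMSEQ_Suc] by simp
    show "\<forall>\<^sub>F n in sequentially. norm (x - s n) \<le> d + 1 / real (Suc n)"
      using s(2) by (simp add: less_imp_le del: of_nat_Suc)
  qed (use dle s(1) in auto)
  define g where "g n = (norm (x - s n))\<^sup>2 - d\<^sup>2" for n
  have g0: "g \<longlonglongrightarrow> 0"
    unfolding g_def using tendsto_diff[OF tendsto_power[OF lim, of 2] tendsto_const[of "d\<^sup>2"]] by simp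
  have "Cauchy s"
  proof (rule metric_CauchyI)
    fix e :: real assume e: "e > 0"
    then obtain N where N: "\<And>n. n \<ge> N \<Longrightarrow> g n < e\<^sup>2 / 4"
      using order_tendstoD(2)[OF g0, of "e\<^sup>2 / 4"] by (auto simp: eventually_sequentially)
    have "dist (s m) (s n) < e" if "m \<ge> N" "n \<ge> N" for m n
    proof -
      have "(norm (s m - s n))\<^sup>2 < e\<^sup>2"
        using gap[OF s(1) s(1), of m n] N[OF that(1)] N[OF that(2)] by (simp add: g_def)
      then show ?thesis
        using e power_less_imp_less_base[of "norm (s m - s n)" 2 e] by (simp add: dist_norm)
    qed
    then show "\<exists>N. \<forall>m\<ge>N. \<forall>n\<ge>N. dist (s m) (s n) < e"
      by blast
  qed
  then obtain z where z: "s \<longlonglongrightarrow> z"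
    using Cauchy_convergent convergent_def by blast
  have zS: "z \<in> S"
    using closed_sequentially[OF clS] s z by blast
  have zd: "norm (x - z) = d"
    using LIMSEQ_unique[OF lim tendsto_norm[OF tendsto_diff[OF tendsto_const z]]] by simp
  show ?thesis
  proof
    show "inner (x - z) t = 0" if t: "t \<in> S" for t
    proof (cases "t = 0")
      case False
      \<comment> \<open>The coefficient that minimizes the distance from \<open>x\<close> along the
        line \<open>z + c *\<^sub>R t\<close>.\<close>
      define c where "c = inner (x - z) t / inner t t"
      have "z + c *\<^sub>R t \<in> S"
        using zS t S by (simp add: subspace_add subspace_scale)
      then have "(norm (x - z))\<^sup>2 \<le> (norm (x - z - c *\<^sub>R t))\<^sup>2"
        using dle zd d0 by (simp add: power_mono diff_diff_eq)
      also have "\<dots> = (norm (x - z))\<^sup>2 - (inner (x - z) t)\<^sup>2 / inner t t"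
      proof -
        have "(norm (x - z - c *\<^sub>R t))\<^sup>2 = (norm (x - z))\<^sup>2 - 2 * c * inner (x - z) t + c * c * inner t t"
          unfolding power2_norm_eq_inner by (simp add: inner_simps inner_commute algebra_simps)
        then show ?thesis
          using False by (simp add: c_def power2_eq_square)
      qed
      finally show ?thesis
        using False inner_gt_zero_iff[of t] by (auto simp: divide_le_0_iff simp del: inner_gt_zero_iff)
    qed simp
  qed (rule zS)
qed


section \<open>The complex inner product\<close>

lemma cinner_add_right: "cinner x (y + z) = cinner x y + cinner x z"
  using cinner_add_left[of y z x] by (metis cinner_commute complex_cnj_add)

lemma cinner_scaleC_right: "cinner x (a *\<^sub>C y) = cnj a * cinner x y"
  using cinner_scaleC_left[of a y x] by (metis cinner_commute complex_cnj_mult)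

lemma cinner_zero_left [simp]: "cinner 0 x = 0"
  using cinner_add_left[of 0 0 x] by simp

lemma cinner_zero_right [simp]: "cinner x 0 = 0"
  using cinner_add_right[of x 0 0] by simp

lemma cinner_minus_left [simp]: "cinner (- x) y = - cinner x y"
  using cinner_add_left[of x "- x" y] by (simp add: eq_neg_iff_add_eq_0 add.commute)

lemma cinner_minus_right [simp]: "cinner x (- y) = - cinner x y"
  using cinner_add_right[of x y "- y"] by (simp add: eq_neg_iff_add_eq_0 add.commute)

lemma cinner_diff_left: "cinner (x - y) z = cinner x z - cinner y z"
  using cinner_add_left[of x "- y" z] by simp

lemma cinner_diff_right: "cinner x (y - z) = cinner x y - cinner x z"
  using cinner_add_right[of x y "- z"] by simp

lemmas cinner_simps = cinner_add_left cinner_add_right cinner_diff_left cinner_diff_right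
  cinner_scaleC_left cinner_scaleC_right

lemma cinner_self_eq_0 [simp]: "cinner x x = 0 \<longleftrightarrow> x = 0"
  using inner_eq_Re_cinner[of x x] by (metis cinner_zero_left inner_eq_zero_iff zero_complex.sel(1))

lemma cinner_eq_0_commute: "cinner x y = 0 \<longleftrightarrow> cinner y x = 0"
  by (metis cinner_commute complex_cnj_zero)

text \<open>The rotation by \<i> is put on \<open>x\<close>, so that \<open>y\<close> enters only
  through real inner products, whose continuity is available.\<close>

lemma cinner_conv_inner: "cinner x y = Complex (inner x y) (inner (- (\<i> *\<^sub>C x)) y)"
  by (simp add: complex_eq_iff inner_eq_Re_cinner cinner_scaleC_left)

lemma continuous_on_cinner_left [continuous_intros]:
  assumes "continuous_on S f"
  shows "continuous_on S (\<lambda>x. cinner (f x) a)"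
proof -
  have "cinner y a = Complex (inner y a) (inner y (\<i> *\<^sub>C a))" for y
    by (simp add: complex_eq_iff inner_eq_Re_cinner cinner_scaleC_right)
  then show ?thesis
    by (simp add: Complex_eq) (intro continuous_intros assms)
qed

lemma continuous_on_cinner_right [continuous_intros]:
  assumes "continuous_on S f"
  shows "continuous_on S (\<lambda>x. cinner a (f x))"
  unfolding cinner_conv_inner Complex_eq by (intro continuous_intros assms)

lemma scaleC_Pair [simp]: "a *\<^sub>C (x, y) = (a *\<^sub>C x, a *\<^sub>C y)"
  by (simp add: scaleC_prod_def)

lemma cinner_Pair [simp]: "cinner (x, y) (u, v) = cinner x u + cinner y v"
  by (simp add: cinner_prod_def)

lemma complex_subspace_imp_subspace: "complex_vector.subspace S \<Longrightarrow> subspace S"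
  by (auto simp: complex_vector.subspace_def subspace_def scaleR_scaleC)

text \<open>A complex subspace contains \<open>\<i> *\<^sub>C t\<close> along with \<open>t\<close>;
  real orthogonality to both kills the real and the imaginary part.\<close>

lemma cinner_orthogonal_decomposition:
  fixes S :: "'a::chilbert_space set"
  assumes S: "complex_vector.subspace S" and clS: "closed S"
  obtains s where "s \<in> S" "\<And>t. t \<in> S \<Longrightarrow> cinner (x - s) t = 0"
proof -
  obtain s where s: "s \<in> S" "\<And>t. t \<in> S \<Longrightarrow> inner (x - s) t = 0"
    using orthogonal_decomposition[OF complex_subspace_imp_subspace[OF S] clS] by blast
  have "cinner (x - s) t = 0" if "t \<in> S" for t
    using s(2)[OF that] s(2)[OF complex_vector.subspace_scale[OF S that, of \<i>]]
    by (simp add: complex_eq_iff inner_eq_Re_cinner cinner_scaleC_right)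
  with s(1) that show thesis
    by blast
qed


section \<open>Adjoints\<close>

lemma mem_adjoint_op: "(g, g') \<in> adjoint_op A \<longleftrightarrow> (\<forall>(f, f')\<in>A. cinner f' g = cinner f g')"
  by (simp add: adjoint_op_def)

lemma adjoint_op_antimono: "A \<subseteq> B \<Longrightarrow> adjoint_op B \<subseteq> adjoint_op A"
  by (auto simp: adjoint_op_def)

lemma subspace_adjoint_op: "complex_vector.subspace (adjoint_op A)"
  by (intro complex_vector.subspaceI)
    (fastforce simp: mem_adjoint_op zero_prod_def cinner_simps)+

lemma closed_adjoint_op: "closed (adjoint_op A)"
proof -
  have "adjoint_op A = (\<Inter>q\<in>A. {p. cinner (snd q) (fst p) = cinner (fst q) (snd p)})"
    by (fastforce simp: adjoint_op_def)
  also have "closed \<dots>"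
    by (intro closed_INT ballI closed_Collect_eq continuous_intros)
  finally show ?thesis .
qed

text \<open>The difference of two values is orthogonal to the dense domain, hence by continuity to
  itself.\<close>

lemma single_valued_adjoint_op:
  assumes "densely_defined A"
  shows "single_valued (adjoint_op A)"
proof (rule single_valuedI)
  fix g u v assume uv: "(g, u) \<in> adjoint_op A" "(g, v) \<in> adjoint_op A"
  have "closed {f. cinner f (u - v) = 0}"
    by (intro closed_Collect_eq continuous_intros)
  moreover have "Domain A \<subseteq> {f. cinner f (u - v) = 0}"
    using uv by (fastforce simp: mem_adjoint_op cinner_diff_right)
  ultimately have "closure (Domain A) \<subseteq> {f. cinner f (u - v) = 0}"
    by (rule closure_minimal[rotated])
  then have "cinner (u - v) (u - v) = 0"
    using assms unfolding densely_defined_def by blast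
  then show "u = v"
    by simp
qed

text \<open>The orthogonal complement of a graph is the adjoint graph rotated by a quarter turn.
  This turns orthogonal projection onto a graph into a statement about adjoints.\<close>

lemma orthogonal_graph_iff:
  "(\<forall>t\<in>A. cinner (u, v) t = 0) \<longleftrightarrow> (v, - u) \<in> adjoint_op A"
proof -
  have "cinner u f + cinner v f' = 0 \<longleftrightarrow> cinner f' v = cinner f (- u)" for f f'
    using cinner_commute[of u f] cinner_commute[of v f']
    by simp (metis add_eq_0_iff complex_cnj_cancel_iff complex_cnj_minus)
  then show ?thesis
    by (simp add: mem_adjoint_op split_beta) (metis cinner_Pair prod.collapse)
qed

text \<open>For \<open>p\<close> in the double adjoint, project \<open>p\<close> onto
  \<open>A\<close>. The rotated residual lies in \<open>adjoint_op A\<close>, so the residual is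
  orthogonal to \<open>p\<close> as well as to the projection, hence to itself.\<close>

lemma adjoint_op_adjoint_op:
  fixes A :: "'a::chilbert_space operator"
  assumes "complex_vector.subspace A" "closed A"
  shows "adjoint_op (adjoint_op A) = A"
proof (intro equalityI subsetI)
  fix p assume p: "p \<in> adjoint_op (adjoint_op A)"
  obtain s where s: "s \<in> A" "\<And>t. t \<in> A \<Longrightarrow> cinner (p - s) t = 0"
    using cinner_orthogonal_decomposition[OF assms] by blast
  obtain x y u v where xy: "p = (x, y)" "p - s = (u, v)"
    by (metis surj_pair)
  have "(v, - u) \<in> adjoint_op A"
    using s xy orthogonal_graph_iff[of A u v] by auto
  moreover have "\<forall>(a, b)\<in>adjoint_op A. cinner b x = cinner a y"
    using p by (simp add: xy(1) mem_adjoint_op[of x y])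
  ultimately have "cinner (- u) x = cinner v y"
    by blast
  then have "cinner (p - s) p = 0"
    unfolding xy(2) unfolding xy(1) by (simp add: add_eq_0_iff)
  then have "cinner (p - s) (p - s) = 0"
    using s by (simp add: cinner_diff_right)
  then have "p - s = 0"
    by (simp only: cinner_self_eq_0)
  with s(1) show "p \<in> A"
    by simp
next
  fix p assume "p \<in> A"
  moreover obtain x y where "p = (x, y)"
    by fastforce
  ultimately have "cinner g' x = cinner g y" if "(g, g') \<in> adjoint_op A" for g g'
    using that cinner_commute[of g' x] cinner_commute[of g y] by (fastforce simp: mem_adjoint_op)
  with \<open>p = (x, y)\<close> show "p \<in> adjoint_op (adjoint_op A)"
    unfolding mem_adjoint_op[of x y] \<open>p = (x, y)\<close> by blast
qed

text \<open>The condition on \<open>z\<close> covers both \<i> and -\<i>: the latter yields von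
  Neumann's decomposition, the former surjectivity of the constructed boundary map.\<close>

lemma selfadjoint_operator_range:
  fixes A :: "'a::chilbert_space operator"
  assumes "selfadjoint_operator A" and z: "z\<^sup>2 = - 1"
  obtains u u' where "(u, u') \<in> A" "u' + z *\<^sub>C u = h"
proof -
  have A: "complex_vector.subspace A" "adjoint_op A = A" "closed A"
    using assms closed_adjoint_op[of A] by (auto simp: selfadjoint_operator_def linear_operator_def)
  \<comment> \<open>The graph space is the sum of the graph of \<open>A\<close> and its rotation by \<open>(g, g') \<mapsto> (- g', g)\<close>; split
    \<open>(- z h, h) = (f, f') + (- g', g)\<close>. Then \<open>f - z g\<close> is mapped to \<open>2 h\<close> by \<open>A + z\<close>.\<close>
  obtain f f' where f: "(f, f') \<in> A"
    "\<And>t. t \<in> A \<Longrightarrow> cinner ((- (z *\<^sub>C h), h) - (f, f')) t = 0"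
    using cinner_orthogonal_decomposition[OF A(1,3)] by (metis surj_pair)
  then have "(h - f', - (- (z *\<^sub>C h) - f)) \<in> adjoint_op A"
    using orthogonal_graph_iff[of A "- (z *\<^sub>C h) - f" "h - f'"] by simp
  then have g: "(h - f', z *\<^sub>C h + f) \<in> A"
    by (simp add: A(2) add.commute)
  define u where "u = f - z *\<^sub>C (h - f')"
  define u' where "u' = f' - z *\<^sub>C (z *\<^sub>C h + f)"
  have zz: "z * z = - 1"
    using z by (simp add: power2_eq_square)
  have "(u, u') \<in> A"
    using complex_vector.subspace_diff[OF A(1) f(1) complex_vector.subspace_scale[OF A(1) g, of z]]
    by (simp add: u_def u'_def)
  then have "((1/2) *\<^sub>C u, (1/2) *\<^sub>C u') \<in> A"
    using complex_vector.subspace_scale[OF A(1), of _ "1/2"] by fastforce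
  moreover have "(1/2) *\<^sub>C u' + z *\<^sub>C (1/2) *\<^sub>C u = h"
  proof -
    have "u' + z *\<^sub>C u = 2 *\<^sub>C h"
      using scaleC_add_left[of 1 1 h]
      by (simp add: u_def u'_def complex_vector.scale_right_diff_distrib scaleC_add_right
          scaleC_scaleC zz scaleC_one)
    moreover have "(1/2) *\<^sub>C u' + z *\<^sub>C (1/2) *\<^sub>C u = (1/2) *\<^sub>C (u' + z *\<^sub>C u)"
      by (simp add: scaleC_add_right scaleC_scaleC mult.commute)
    ultimately show ?thesis
      by (simp add: scaleC_scaleC scaleC_one)
  qed
  ultimately show thesis
    using that by blast
qed

lemma clinear_onD:
  assumes "clinear_on V T"
  shows "x \<in> V \<Longrightarrow> y \<in> V \<Longrightarrow> T (x + y) = T x + T y"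
    and "x \<in> V \<Longrightarrow> T (a *\<^sub>C x) = a *\<^sub>C T x"
  using assms by (auto simp: clinear_on_def)

lemma clinear_on_diff:
  assumes "clinear_on V T" "complex_vector.subspace V" "x \<in> V" "y \<in> V"
  shows "T (x - y) = T x - T y"
  using clinear_onD(1)[OF assms(1,3), of "- 1 *\<^sub>C y"] clinear_onD(2)[OF assms(1,4), of "- 1"]
    complex_vector.subspace_scale[OF assms(2,4), of "- 1"]
  by (simp add: scaleC_one)

lemma clinear_on_0:
  assumes "clinear_on V T" "complex_vector.subspace V"
  shows "T 0 = 0"
  using clinear_on_diff[OF assms, of 0 0] complex_vector.subspace_0[OF assms(2)] by simp

lemma subspace_Domain:
  assumes "complex_vector.subspace R"
  shows "complex_vector.subspace (Domain R)"
  using complex_vector.subspace_0[OF assms] complex_vector.subspace_add[OF assms]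
    complex_vector.subspace_scale[OF assms]
  by (intro complex_vector.subspaceI) (force simp: Domain_iff zero_prod_def)+


section \<open>Boundary triplets\<close>

locale closed_symmetric =
  fixes A :: "'h::chilbert_space operator"
  assumes linear: "linear_operator A"
    and closed: "closed A"
    and dense: "densely_defined A"
    and symmetric: "symmetric_operator A"
begin

lemma subset_adjoint: "A \<subseteq> adjoint_op A"
  using symmetric by (fastforce simp: symmetric_operator_def adjoint_op_def)

lemma adjoint_unique: "(f, u) \<in> adjoint_op A \<Longrightarrow> (f, v) \<in> adjoint_op A \<Longrightarrow> u = v"
  using single_valued_adjoint_op[OF dense] by (auto dest: single_valuedD)

lemma subspace_Domain_adjoint: "complex_vector.subspace (Domain (adjoint_op A))"
  by (intro subspace_Domain subspace_adjoint_op)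

end

section \<open>Properties of a given boundary triplet: kernels, transversality, boundedness\<close>

locale symmetric_triplet = closed_symmetric A
  for A :: "'h::chilbert_space operator" +
  fixes H :: "'k::chilbert_space set" and \<Gamma>\<^sub>0 \<Gamma>\<^sub>1 :: "'h \<Rightarrow> 'k"
  assumes triplet: "boundary_triplet A H \<Gamma>\<^sub>0 \<Gamma>\<^sub>1"
begin

lemma subspace_H: "complex_vector.subspace H" and closed_H: "closed H"
  and clinear_\<Gamma>\<^sub>0: "clinear_on (Domain (adjoint_op A)) \<Gamma>\<^sub>0"
  and clinear_\<Gamma>\<^sub>1: "clinear_on (Domain (adjoint_op A)) \<Gamma>\<^sub>1"
  using triplet by (auto simp: boundary_triplet_def)

lemma green:
  assumes "(f, f') \<in> adjoint_op A" "(g, g') \<in> adjoint_op A"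
  shows "cinner f' g - cinner f g' = cinner (\<Gamma>\<^sub>1 f) (\<Gamma>\<^sub>0 g) - cinner (\<Gamma>\<^sub>0 f) (\<Gamma>\<^sub>1 g)"
  using triplet assms unfolding boundary_triplet_def by fastforce

lemma onto:
  assumes "k \<in> H" "h \<in> H"
  obtains f f' where "(f, f') \<in> adjoint_op A" "\<Gamma>\<^sub>0 f = h" "\<Gamma>\<^sub>1 f = k"
proof -
  have "(k, h) \<in> (\<lambda>f. (\<Gamma>\<^sub>1 f, \<Gamma>\<^sub>0 f)) ` Domain (adjoint_op A)"
    using triplet assms by (simp add: boundary_triplet_def)
  with that show thesis
    by auto
qed

lemma boundary_values:
  assumes "f \<in> Domain (adjoint_op A)"
  shows "\<Gamma>\<^sub>0 f \<in> H" "\<Gamma>\<^sub>1 f \<in> H"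
proof -
  have "(\<Gamma>\<^sub>1 f, \<Gamma>\<^sub>0 f) \<in> H \<times> H"
    using triplet assms unfolding boundary_triplet_def by blast
  then show "\<Gamma>\<^sub>0 f \<in> H" "\<Gamma>\<^sub>1 f \<in> H"
    by auto
qed

lemmas \<Gamma>_add = clinear_onD(1)[OF clinear_\<Gamma>\<^sub>0] clinear_onD(1)[OF clinear_\<Gamma>\<^sub>1]
lemmas \<Gamma>_scale = clinear_onD(2)[OF clinear_\<Gamma>\<^sub>0] clinear_onD(2)[OF clinear_\<Gamma>\<^sub>1]
lemmas \<Gamma>_diff = clinear_on_diff[OF clinear_\<Gamma>\<^sub>0 subspace_Domain_adjoint]
  clinear_on_diff[OF clinear_\<Gamma>\<^sub>1 subspace_Domain_adjoint]
lemmas \<Gamma>_0 = clinear_on_0[OF clinear_\<Gamma>\<^sub>0 subspace_Domain_adjoint]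
  clinear_on_0[OF clinear_\<Gamma>\<^sub>1 subspace_Domain_adjoint]

lemma zero_in_H: "0 \<in> H"
  using complex_vector.subspace_0[OF subspace_H] .

text \<open>Surjectivity provides \<open>g\<close> with boundary values \<open>(k, 0)\<close> and
  \<open>(0, h)\<close>. Thus boundary values are determined by their pairing with all others, which
  is how Green's identity identifies them.\<close>

lemma boundary_form_nondegenerate:
  assumes "k \<in> H" "h \<in> H"
    and form: "\<And>g. g \<in> Domain (adjoint_op A) \<Longrightarrow> cinner k (\<Gamma>\<^sub>0 g) - cinner h (\<Gamma>\<^sub>1 g) = 0"
  shows "k = 0 \<and> h = 0"
proof
  obtain g g' where g: "(g, g') \<in> adjoint_op A" "\<Gamma>\<^sub>0 g = k" "\<Gamma>\<^sub>1 g = 0"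
    using onto[OF zero_in_H assms(1)] .
  then have "cinner k k = 0"
    using form[of g] by auto
  then show "k = 0"
    by simp
next
  obtain g g' where g: "(g, g') \<in> adjoint_op A" "\<Gamma>\<^sub>0 g = 0" "\<Gamma>\<^sub>1 g = h"
    using onto[OF assms(2) zero_in_H] .
  then have "cinner h h = 0"
    using form[of g] by auto
  then show "h = 0"
    by simp
qed

text \<open>On \<open>A\<close> the left side of Green's identity vanishes, so nondegeneracy gives
  zero boundary values. Conversely, zero boundary values put \<open>(f, f')\<close> into the double
  adjoint, which is \<open>A\<close>.\<close>

lemma Domain_eq_kernel: "f \<in> Domain A \<longleftrightarrow> f \<in> Domain (adjoint_op A) \<and> \<Gamma>\<^sub>0 f = 0 \<and> \<Gamma>\<^sub>1 f = 0"
proof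
  assume "f \<in> Domain A"
  then obtain f' where f: "(f, f') \<in> A"
    by blast
  then have fD: "(f, f') \<in> adjoint_op A"
    using subset_adjoint by blast
  have "cinner (\<Gamma>\<^sub>1 f) (\<Gamma>\<^sub>0 g) - cinner (\<Gamma>\<^sub>0 f) (\<Gamma>\<^sub>1 g) = 0" if g: "g \<in> Domain (adjoint_op A)" for g
  proof -
    obtain g' where g: "(g, g') \<in> adjoint_op A"
      using g by blast
    then have "cinner f' g = cinner f g'"
      using f by (auto simp: mem_adjoint_op)
    then show ?thesis
      using green[OF fD g] by simp
  qed
  then have "\<Gamma>\<^sub>1 f = 0 \<and> \<Gamma>\<^sub>0 f = 0"
    by (intro boundary_form_nondegenerate boundary_values) (use fD in auto)
  then show "f \<in> Domain (adjoint_op A) \<and> \<Gamma>\<^sub>0 f = 0 \<and> \<Gamma>\<^sub>1 f = 0"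
    using fD by blast
next
  assume f: "f \<in> Domain (adjoint_op A) \<and> \<Gamma>\<^sub>0 f = 0 \<and> \<Gamma>\<^sub>1 f = 0"
  then obtain f' where f': "(f, f') \<in> adjoint_op A"
    by blast
  have "(f, f') \<in> adjoint_op (adjoint_op A)"
    unfolding mem_adjoint_op[of f f']
    using green[OF _ f'] f by fastforce
  then show "f \<in> Domain A"
    using adjoint_op_adjoint_op[OF _ closed] linear by (auto simp: linear_operator_def)
qed

definition kernel_extension :: "'h operator"
  where "kernel_extension = {(f, f'). (f, f') \<in> adjoint_op A \<and> \<Gamma>\<^sub>0 f = 0}"

lemma Domain_kernel_extension: "Domain kernel_extension = {f \<in> Domain (adjoint_op A). \<Gamma>\<^sub>0 f = 0}"
  by (auto simp: kernel_extension_def)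

lemma subset_kernel_extension: "A \<subseteq> kernel_extension"
  using subset_adjoint Domain_eq_kernel by (fastforce simp: kernel_extension_def)

lemma kernel_extension_subset: "kernel_extension \<subseteq> adjoint_op A"
  by (auto simp: kernel_extension_def)

lemma linear_kernel_extension: "linear_operator kernel_extension"
proof -
  have "complex_vector.subspace kernel_extension"
    using complex_vector.subspace_0[OF subspace_adjoint_op[of A]]
      complex_vector.subspace_add[OF subspace_adjoint_op[of A]]
      complex_vector.subspace_scale[OF subspace_adjoint_op[of A]]
    by (intro complex_vector.subspaceI)
      (fastforce simp: kernel_extension_def zero_prod_def \<Gamma>_0 \<Gamma>_add \<Gamma>_scale DomainI)+
  moreover have "single_valued kernel_extension"
    using single_valued_subset[OF kernel_extension_subset] single_valued_adjoint_op[OF dense] by blast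
  ultimately show ?thesis
    by (simp add: linear_operator_def)
qed

lemma selfadjoint_kernel_extension: "selfadjoint_operator kernel_extension"
proof -
  have "densely_defined kernel_extension"
    using dense closure_mono[OF Domain_mono[OF subset_kernel_extension]]
    by (auto simp: densely_defined_def)
  moreover have "adjoint_op kernel_extension = kernel_extension"
  proof (intro equalityI subrelI)
    fix g g' assume g: "(g, g') \<in> adjoint_op kernel_extension"
    then have gA: "(g, g') \<in> adjoint_op A"
      using adjoint_op_antimono[OF subset_kernel_extension] by blast
    \<comment> \<open>A test element of the kernel extension for which Green's identity reduces to
      the squared norm of \<open>\<Gamma>\<^sub>0 g\<close>.\<close>
    then obtain f f' where f: "(f, f') \<in> adjoint_op A" "\<Gamma>\<^sub>0 f = 0" "\<Gamma>\<^sub>1 f = \<Gamma>\<^sub>0 g"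
      using onto[OF boundary_values(1) zero_in_H] by blast
    then have "cinner f' g = cinner f g'"
      using g by (auto simp: mem_adjoint_op kernel_extension_def)
    then have "cinner (\<Gamma>\<^sub>0 g) (\<Gamma>\<^sub>0 g) = 0"
      using green[OF f(1) gA] f by simp
    then show "(g, g') \<in> kernel_extension"
      using gA by (simp add: kernel_extension_def)
  next
    fix g g' assume g: "(g, g') \<in> kernel_extension"
    have "cinner f' g = cinner f g'" if "(f, f') \<in> kernel_extension" for f f'
      using green[of f f' g g'] that g by (simp add: kernel_extension_def)
    then show "(g, g') \<in> adjoint_op kernel_extension"
      unfolding mem_adjoint_op by blast
  qed
  ultimately show ?thesis
    using linear_kernel_extension by (simp add: selfadjoint_operator_def)
qed

text \<open>Surjectivity gives \<open>g\<close> with boundary values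
  \<open>\<Gamma>\<^sub>0 f\<close> and \<open>B (\<Gamma>\<^sub>0 f)\<close>; then \<open>g\<close>
  lies in \<open>Domain At\<close> and \<open>f - g\<close> in the kernel of
  \<open>\<Gamma>\<^sub>0\<close>. The intersection is \<open>Domain A\<close> because
  \<open>B 0 = 0\<close>.\<close>

lemma transversal_kernel_extension:
  assumes At: "proper_extension A At" and B: "bounded_operator_on H B"
    and Dom: "Domain At = {f \<in> Domain (adjoint_op A). \<Gamma>\<^sub>1 f = B (\<Gamma>\<^sub>0 f)}"
  shows "transversal A At kernel_extension"
proof -
  have B0: "B 0 = 0"
    using B subspace_H by (intro clinear_on_0) (auto simp: bounded_operator_on_def)
  have "Domain At \<inter> Domain kernel_extension = Domain A"
    unfolding Dom Domain_kernel_extension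
    by (rule set_eqI) (use B0 in \<open>auto simp only: Domain_eq_kernel Int_iff mem_Collect_eq\<close>)
  moreover have "{f + g |f g. f \<in> Domain At \<and> g \<in> Domain kernel_extension} = Domain (adjoint_op A)"
  proof (intro equalityI subsetI)
    fix f assume f: "f \<in> Domain (adjoint_op A)"
    have "B (\<Gamma>\<^sub>0 f) \<in> H"
      using B boundary_values[OF f] by (auto simp: bounded_operator_on_def)
    then obtain g g' where g: "(g, g') \<in> adjoint_op A" "\<Gamma>\<^sub>0 g = \<Gamma>\<^sub>0 f" "\<Gamma>\<^sub>1 g = B (\<Gamma>\<^sub>0 f)"
      using onto boundary_values(1)[OF f] by metis
    then have "g \<in> Domain (adjoint_op A)"
      by blast
    then have "g \<in> Domain At" "f - g \<in> Domain kernel_extension"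
      using f g complex_vector.subspace_diff[OF subspace_Domain_adjoint]
      unfolding Dom Domain_kernel_extension by (auto simp: \<Gamma>_diff)
    moreover have "f = g + (f - g)"
      by simp
    ultimately show "f \<in> {f + g |f g. f \<in> Domain At \<and> g \<in> Domain kernel_extension}"
      by blast
  next
    fix f assume "f \<in> {f + g |f g. f \<in> Domain At \<and> g \<in> Domain kernel_extension}"
    then obtain g h where "f = g + h" "g \<in> Domain (adjoint_op A)" "h \<in> Domain (adjoint_op A)"
      unfolding Dom Domain_kernel_extension by blast
    then show "f \<in> Domain (adjoint_op A)"
      using complex_vector.subspace_add[OF subspace_Domain_adjoint] by blast
  qed
  ultimately show ?thesis
    using At linear_kernel_extension subset_kernel_extension kernel_extension_subset
    by (simp add: transversal_def proper_extension_def)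
qed

text \<open>Closed graph theorem on the Hilbert space \<open>adjoint_op A\<close> with the graph
  norm. Closedness of the graph \<open>G\<close> comes from Green's identity, which expresses
  membership through closed conditions.\<close>

lemma boundary_maps_bounded:
  obtains K where "\<And>p. p \<in> adjoint_op A \<Longrightarrow>
    norm (\<Gamma>\<^sub>0 (fst p)) \<le> K * norm p \<and> norm (\<Gamma>\<^sub>1 (fst p)) \<le> K * norm p"
proof -
  define G where "G = {(p, k). p \<in> adjoint_op A \<and> k = (\<Gamma>\<^sub>1 (fst p), \<Gamma>\<^sub>0 (fst p))}"
  have "G = ((adjoint_op A \<times> (H \<times> H)) \<inter> (\<Inter>r\<in>adjoint_op A.
      {q. cinner (snd (fst q)) (fst r) - cinner (fst (fst q)) (snd r) =
        cinner (fst (snd q)) (\<Gamma>\<^sub>0 (fst r)) - cinner (snd (snd q)) (\<Gamma>\<^sub>1 (fst r))}))" (is "_ = ?G")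
  proof (intro equalityI subsetI)
    fix q assume "q \<in> G"
    then show "q \<in> ?G"
      using green boundary_values[OF DomainI] by (auto simp: G_def)
  next
    fix q assume q: "q \<in> ?G"
    obtain f f' k h where q_eq: "q = ((f, f'), (k, h))"
      by (metis surj_pair)
    have f: "(f, f') \<in> adjoint_op A" "k \<in> H" "h \<in> H" "f \<in> Domain (adjoint_op A)"
      using q q_eq by auto
    \<comment> \<open>Subtracting the condition on \<open>q\<close> from Green's identity for
      \<open>f\<close> shows that \<open>(k, h)\<close> has the same pairings as the true boundary
      values.\<close>
    have "cinner (\<Gamma>\<^sub>1 f - k) (\<Gamma>\<^sub>0 g) - cinner (\<Gamma>\<^sub>0 f - h) (\<Gamma>\<^sub>1 g) = 0"
      if gD: "g \<in> Domain (adjoint_op A)" for g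
    proof -
      obtain g' where g: "(g, g') \<in> adjoint_op A"
        using gD by blast
      then have "cinner f' g - cinner f g' = cinner k (\<Gamma>\<^sub>0 g) - cinner h (\<Gamma>\<^sub>1 g)"
        using q q_eq by fastforce
      then show ?thesis
        using green[OF f(1) g] by (simp add: cinner_diff_left algebra_simps)
    qed
    then have "\<Gamma>\<^sub>1 f - k = 0 \<and> \<Gamma>\<^sub>0 f - h = 0"
      using f by (intro boundary_form_nondegenerate complex_vector.subspace_diff[OF subspace_H]
          boundary_values)
    then show "q \<in> G"
      using f by (simp add: G_def q_eq)
  qed
  moreover have "closed ?G"
    by (intro closed_Int closed_Times closed_adjoint_op closed_H closed_INT
        ballI closed_Collect_eq continuous_intros)
  ultimately have "closed G"
    by simp
  moreover have "subspace G"
  proof (rule subspaceI)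
    have fst_Domain: "fst p \<in> Domain (adjoint_op A)" if "p \<in> adjoint_op A" for p
      using that by (metis DomainI prod.collapse)
    show "0 \<in> G"
      using complex_vector.subspace_0[OF subspace_adjoint_op[of A]]
      by (simp add: G_def zero_prod_def \<Gamma>_0)
    show "x + y \<in> G" if "x \<in> G" "y \<in> G" for x y
      using that complex_vector.subspace_add[OF subspace_adjoint_op[of A]]
      by (cases x; cases y) (simp add: G_def \<Gamma>_add fst_Domain)
    show "c *\<^sub>R x \<in> G" if "x \<in> G" for c x
      using that complex_vector.subspace_scale[OF subspace_adjoint_op[of A]]
      by (cases x) (simp add: G_def scaleR_scaleC scaleC_prod_def \<Gamma>_scale fst_Domain)
  qed
  moreover have dom: "Domain G = adjoint_op A"
    by (auto simp: G_def)
  ultimately obtain K where K: "\<And>p. p \<in> adjoint_op A \<Longrightarrow> \<exists>k. (p, k) \<in> G \<and> norm k \<le> K * norm p"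
    using bounded_selection[of G] closed_adjoint_op[of A] by metis
  show thesis
  proof
    fix p assume "p \<in> adjoint_op A"
    then have "norm (\<Gamma>\<^sub>1 (fst p), \<Gamma>\<^sub>0 (fst p)) \<le> K * norm p"
      using K by (fastforce simp: G_def)
    then show "norm (\<Gamma>\<^sub>0 (fst p)) \<le> K * norm p \<and> norm (\<Gamma>\<^sub>1 (fst p)) \<le> K * norm p"
      using norm_fst_le[of "\<Gamma>\<^sub>1 (fst p)" "\<Gamma>\<^sub>0 (fst p)"] norm_snd_le[of "\<Gamma>\<^sub>0 (fst p)" "\<Gamma>\<^sub>1 (fst p)"]
      by linarith
  qed
qed

end

section \<open>The bounded parameter \<open>B\<close> of a closed transversal extension\<close>

context symmetric_triplet
begin

text \<open>Open mapping theorem for \<open>\<Gamma>\<^sub>0\<close> on the graph of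
  \<open>At\<close>, a complete space because \<open>At\<close> is closed.\<close>

lemma bounded_lift:
  assumes At: "At \<subseteq> adjoint_op A" "complex_vector.subspace At" "closed At"
    and lift: "\<And>h. h \<in> H \<Longrightarrow> \<exists>f\<in>Domain At. \<Gamma>\<^sub>0 f = h"
  obtains L where "\<And>h. h \<in> H \<Longrightarrow> \<exists>p\<in>At. \<Gamma>\<^sub>0 (fst p) = h \<and> norm p \<le> L * norm h"
proof -
  obtain K where K: "\<And>p. p \<in> adjoint_op A \<Longrightarrow> norm (\<Gamma>\<^sub>0 (fst p)) \<le> K * norm p"
    using boundary_maps_bounded by metis
  have fst_Domain: "fst p \<in> Domain (adjoint_op A)" if "p \<in> At" for p
    using that At(1) by (metis DomainI prod.collapse subsetD)
  \<comment> \<open>The inverse graph of \<open>\<Gamma>\<^sub>0\<close> on \<open>At\<close>, so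
    that a bounded selection of \<open>R\<close> is a bounded lift.\<close>
  define R where "R = {q. snd q \<in> At \<and> fst q = \<Gamma>\<^sub>0 (fst (snd q))}"
  have "subspace R"
  proof (rule subspaceI)
    show "0 \<in> R"
      using complex_vector.subspace_0[OF At(2)] by (simp add: R_def zero_prod_def \<Gamma>_0)
    show "x + y \<in> R" if "x \<in> R" "y \<in> R" for x y
      using that complex_vector.subspace_add[OF At(2)]
      by (simp add: R_def \<Gamma>_add fst_Domain)
    show "c *\<^sub>R x \<in> R" if "x \<in> R" for c x
      using that complex_vector.subspace_scale[OF At(2)]
      by (simp add: R_def scaleR_scaleC scaleC_prod_def \<Gamma>_scale fst_Domain)
  qed
  moreover have "closed R"
    unfolding closed_sequential_limits
  proof (intro allI impI, elim conjE)
    fix q l assume q: "\<forall>n. q n \<in> R" and lim: "q \<longlonglongrightarrow> l"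
    have qn: "snd (q n) \<in> At" "fst (q n) = \<Gamma>\<^sub>0 (fst (snd (q n)))" for n
      using q by (auto simp: R_def)
    have lims: "(\<lambda>n. fst (q n)) \<longlonglongrightarrow> fst l" "(\<lambda>n. snd (q n)) \<longlonglongrightarrow> snd l"
      by (intro tendsto_intros lim)+
    have l: "snd l \<in> At"
      by (rule closed_sequentially[OF At(3) qn(1) lims(2)])
    have "(\<lambda>n. fst (q n) - \<Gamma>\<^sub>0 (fst (snd l))) \<longlonglongrightarrow> 0"
    proof (rule Lim_null_comparison)
      show "\<forall>\<^sub>F n in sequentially.
          norm (fst (q n) - \<Gamma>\<^sub>0 (fst (snd l))) \<le> K * norm (snd (q n) - snd l)"
      proof (rule always_eventually, rule allI)
        fix n
        have "snd (q n) - snd l \<in> adjoint_op A"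
          using At(1) complex_vector.subspace_diff[OF At(2) qn(1) l] by blast
        then show "norm (fst (q n) - \<Gamma>\<^sub>0 (fst (snd l))) \<le> K * norm (snd (q n) - snd l)"
          using K[of "snd (q n) - snd l"] qn l by (simp add: \<Gamma>_diff fst_Domain)
      qed
      have "(\<lambda>n. K * norm (snd (q n) - snd l)) \<longlonglongrightarrow> K * norm (snd l - snd l)"
        by (intro tendsto_intros lims)
      then show "(\<lambda>n. K * norm (snd (q n) - snd l)) \<longlonglongrightarrow> 0"
        by simp
    qed
    then have "(\<lambda>n. fst (q n)) \<longlonglongrightarrow> \<Gamma>\<^sub>0 (fst (snd l))"
      by (simp add: LIM_zero_iff)
    then have "fst l = \<Gamma>\<^sub>0 (fst (snd l))"
      using LIMSEQ_unique lims(1) by blast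
    with l show "l \<in> R"
      by (auto simp: R_def)
  qed
  moreover have DR: "Domain R = H"
  proof
    show "Domain R \<subseteq> H"
      using boundary_values(1)[OF fst_Domain] by (auto simp: R_def)
    show "H \<subseteq> Domain R"
      using lift by (fastforce simp: R_def Domain_iff)
  qed
  ultimately obtain L where L: "\<And>h. h \<in> H \<Longrightarrow> \<exists>p. (h, p) \<in> R \<and> norm p \<le> L * norm h"
    using bounded_selection[of R] closed_H by metis
  show thesis
    using L that by (fastforce simp: R_def)
qed

text \<open>The sum condition makes \<open>\<Gamma>\<^sub>0\<close> map \<open>Domain At\<close>
  onto \<open>H\<close>, and the intersection condition makes \<open>\<Gamma>\<^sub>1\<close> depend
  on \<open>\<Gamma>\<^sub>0\<close> alone there. The bound on \<open>B\<close> is that of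
  \<open>\<Gamma>\<^sub>1\<close> composed with a bounded lift.\<close>

theorem bounded_parameter:
  assumes At: "closed At" and tr: "transversal A At A\<^sub>0"
    and ker: "{f \<in> Domain (adjoint_op A). \<Gamma>\<^sub>0 f = 0} = Domain A\<^sub>0"
  shows "\<exists>B. bounded_operator_on H B \<and>
    Domain At = {f \<in> Domain (adjoint_op A). \<Gamma>\<^sub>1 f = B (\<Gamma>\<^sub>0 f)}"
proof -
  have At': "At \<subseteq> adjoint_op A" "A \<subseteq> At" "complex_vector.subspace At"
    and Int: "Domain At \<inter> Domain A\<^sub>0 = Domain A"
    and Sum: "{f + g |f g. f \<in> Domain At \<and> g \<in> Domain A\<^sub>0} = Domain (adjoint_op A)"
    using tr by (auto simp: transversal_def proper_extension_def linear_operator_def)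
  have D: "f \<in> Domain (adjoint_op A)" if "f \<in> Domain At" for f
    using that At'(1) by blast
  have subD: "complex_vector.subspace (Domain At)"
    by (rule subspace_Domain[OF At'(3)])
  have lift: "\<exists>f\<in>Domain At. \<Gamma>\<^sub>0 f = h" if h: "h \<in> H" for h
  proof -
    obtain F F' where F: "(F, F') \<in> adjoint_op A" "\<Gamma>\<^sub>0 F = h"
      using onto[OF zero_in_H h] .
    then obtain f g where fg: "F = f + g" "f \<in> Domain At" "g \<in> Domain A\<^sub>0"
      using Sum by blast
    then have "g \<in> Domain (adjoint_op A)" "\<Gamma>\<^sub>0 g = 0"
      using ker by auto
    then have "\<Gamma>\<^sub>0 f = h"
      using F(2) fg D by (simp add: \<Gamma>_add)
    with fg(2) show ?thesis
      by blast
  qed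
  have well_defined: "\<Gamma>\<^sub>1 f = \<Gamma>\<^sub>1 g"
    if "f \<in> Domain At" "g \<in> Domain At" "\<Gamma>\<^sub>0 f = \<Gamma>\<^sub>0 g" for f g
  proof -
    have "f - g \<in> Domain At \<inter> {f \<in> Domain (adjoint_op A). \<Gamma>\<^sub>0 f = 0}"
      using that D complex_vector.subspace_diff[OF subD that(1,2)] by (simp add: \<Gamma>_diff)
    then have "f - g \<in> Domain A"
      unfolding ker Int .
    then have "\<Gamma>\<^sub>1 (f - g) = 0"
      by (simp only: Domain_eq_kernel)
    then show ?thesis
      using that D by (simp add: \<Gamma>_diff)
  qed
  \<comment> \<open>For \<open>h\<close> in \<open>H\<close> the choice is immaterial by
    \<open>well_defined\<close>; outside \<open>H\<close> the value is irrelevant.\<close>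
  define B where "B h = \<Gamma>\<^sub>1 (SOME f. f \<in> Domain At \<and> \<Gamma>\<^sub>0 f = h)" for h
  have B: "B (\<Gamma>\<^sub>0 f) = \<Gamma>\<^sub>1 f" if "f \<in> Domain At" for f
    unfolding B_def by (rule someI2[of _ f]) (use that well_defined in blast)+
  obtain L where L: "\<And>h. h \<in> H \<Longrightarrow> \<exists>p\<in>At. \<Gamma>\<^sub>0 (fst p) = h \<and> norm p \<le> L * norm h"
    using bounded_lift[OF At'(1,3) At lift] by blast
  obtain K where K: "\<And>p. p \<in> adjoint_op A \<Longrightarrow> norm (\<Gamma>\<^sub>1 (fst p)) \<le> K * norm p"
    using boundary_maps_bounded by metis
  have "norm (B h) \<le> (\<bar>K\<bar> * L) * norm h" if h: "h \<in> H" for h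
  proof -
    obtain p where p: "p \<in> At" "\<Gamma>\<^sub>0 (fst p) = h" "norm p \<le> L * norm h"
      using L[OF h] by blast
    have "B h = \<Gamma>\<^sub>1 (fst p)"
      using B[of "fst p"] p by (metis DomainI prod.collapse)
    also have "norm \<dots> \<le> K * norm p"
      using K p(1) At'(1) by blast
    \<comment> \<open>The sign of \<open>K\<close> is unknown, and multiplying the bound on
      \<open>norm p\<close> needs a nonnegative factor.\<close>
    also have "\<dots> \<le> \<bar>K\<bar> * norm p"
      by (simp add: mult_right_mono)
    also have "\<dots> \<le> \<bar>K\<bar> * (L * norm h)"
      using p(3) by (simp add: mult_left_mono)
    finally show ?thesis
      by (simp add: mult.assoc)
  qed
  moreover have "B ` H \<subseteq> H"
    using lift B boundary_values(2)[OF D] by force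
  moreover have "clinear_on H B"
    unfolding clinear_on_def
  proof (intro conjI ballI allI)
    fix x y assume "x \<in> H" "y \<in> H"
    then obtain f g where fg: "f \<in> Domain At" "\<Gamma>\<^sub>0 f = x" "g \<in> Domain At" "\<Gamma>\<^sub>0 g = y"
      using lift by blast
    then show "B (x + y) = B x + B y"
      using B[of f] B[of g] B[OF complex_vector.subspace_add[OF subD fg(1,3)]] D
      by (simp add: \<Gamma>_add)
  next
    fix a x assume "x \<in> H"
    then obtain f where f: "f \<in> Domain At" "\<Gamma>\<^sub>0 f = x"
      using lift by blast
    then show "B (a *\<^sub>C x) = a *\<^sub>C B x"
      using B[of f] B[OF complex_vector.subspace_scale[OF subD f(1)]] D
      by (simp add: \<Gamma>_scale)
  qed
  moreover have "Domain At = {f \<in> Domain (adjoint_op A). \<Gamma>\<^sub>1 f = B (\<Gamma>\<^sub>0 f)}"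
  proof (intro equalityI subsetI)
    fix f assume "f \<in> Domain At"
    then show "f \<in> {f \<in> Domain (adjoint_op A). \<Gamma>\<^sub>1 f = B (\<Gamma>\<^sub>0 f)}"
      using D B by simp
  next
    fix f assume "f \<in> {f \<in> Domain (adjoint_op A). \<Gamma>\<^sub>1 f = B (\<Gamma>\<^sub>0 f)}"
    then have f: "f \<in> Domain (adjoint_op A)" "\<Gamma>\<^sub>1 f = B (\<Gamma>\<^sub>0 f)"
      by auto
    \<comment> \<open>\<open>g\<close> shares both boundary values with \<open>f\<close>, so the two
      differ by an element of \<open>Domain A\<close>, which is contained in
      \<open>Domain At\<close>.\<close>
    obtain g where g: "g \<in> Domain At" "\<Gamma>\<^sub>0 g = \<Gamma>\<^sub>0 f"
      using lift boundary_values(1)[OF f(1)] by blast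
    have "\<Gamma>\<^sub>1 g = \<Gamma>\<^sub>1 f"
      using B[OF g(1)] g(2) f(2) by simp
    then have "f - g \<in> Domain A"
      unfolding Domain_eq_kernel using f(1) g D[OF g(1)]
      by (simp add: \<Gamma>_diff complex_vector.subspace_diff[OF subspace_Domain_adjoint])
    then have "f - g \<in> Domain At"
      using At'(2) by blast
    then have "f - g + g \<in> Domain At"
      by (rule complex_vector.subspace_add[OF subD _ g(1)])
    then show "f \<in> Domain At"
      by simp
  qed
  ultimately show ?thesis
    unfolding bounded_operator_on_def by blast
qed

end

section \<open>Construction of a boundary triplet from a self-adjoint extension\<close>

locale selfadjoint_extension = closed_symmetric A
  for A :: "'h::chilbert_space operator" +
  fixes A\<^sub>0 :: "'h operator"
  assumes selfadjoint: "selfadjoint_operator A\<^sub>0" and extends: "A \<subseteq> A\<^sub>0"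
begin

abbreviation "N \<equiv> deficiency_space A \<i>"

lemma extension_subset_adjoint: "A\<^sub>0 \<subseteq> adjoint_op A"
  using adjoint_op_antimono[OF extends] selfadjoint by (simp add: selfadjoint_operator_def)

lemma subspace_extension: "complex_vector.subspace A\<^sub>0"
  using selfadjoint by (simp add: selfadjoint_operator_def linear_operator_def)

lemma extension_symmetric: "(f, f') \<in> A\<^sub>0 \<Longrightarrow> (g, g') \<in> A\<^sub>0 \<Longrightarrow> cinner f' g = cinner f g'"
  using selfadjoint mem_adjoint_op[of g g' A\<^sub>0] by (auto simp: selfadjoint_operator_def)

lemma mem_N: "a \<in> N \<longleftrightarrow> (a, \<i> *\<^sub>C a) \<in> adjoint_op A"
  by (simp add: deficiency_space_def)

lemma subspace_N: "complex_vector.subspace N"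
proof (rule complex_vector.subspaceI)
  show "0 \<in> N"
    using complex_vector.subspace_0[OF subspace_adjoint_op[of A]] by (simp add: mem_N zero_prod_def)
  show "x + y \<in> N" if "x \<in> N" "y \<in> N" for x y
    using that complex_vector.subspace_add[OF subspace_adjoint_op[of A]]
    by (fastforce simp: mem_N scaleC_add_right)
  show "c *\<^sub>C x \<in> N" if "x \<in> N" for c x
    using that complex_vector.subspace_scale[OF subspace_adjoint_op[of A], of "(x, \<i> *\<^sub>C x)" c]
    by (simp add: mem_N scaleC_scaleC mult.commute)
qed

text \<open>\<open>N\<close> is the orthogonal complement of the range of
  \<open>A + \<i>\<close>.\<close>

lemma closed_N: "closed N"
proof -
  have "cinner g' a = cinner g (\<i> *\<^sub>C a) \<longleftrightarrow> cinner (g' + \<i> *\<^sub>C g) a = 0" for g g' a :: 'h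
    by (simp add: cinner_simps eq_neg_iff_add_eq_0)
  then have "N = (\<Inter>q\<in>A. {a. cinner (snd q + \<i> *\<^sub>C fst q) a = 0})"
    by (fastforce simp: deficiency_space_def mem_adjoint_op)
  also have "closed \<dots>"
    by (intro closed_INT ballI closed_Collect_eq continuous_intros)
  finally show ?thesis .
qed

text \<open>
  By von Neumann's decomposition every \<open>f \<in> dom A\<^sup>*\<close> is \<open>u + a\<close> with \<open>u \<in> dom A\<^sub>0\<close> and
  \<open>a \<in> N\<close>. The boundary values are \<open>\<Gamma>\<^sub>0 f = a\<close> and \<open>\<Gamma>\<^sub>1 f = P (A\<^sub>0 + \<i>) u + \<i> a\<close>, where \<open>P\<close> is
  the orthogonal projection onto \<open>N\<close>.
\<close>

definition boundary_value :: "'h \<Rightarrow> 'h \<times> 'h \<Rightarrow> bool"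
  where "boundary_value f p \<longleftrightarrow> fst p \<in> N \<and> snd p \<in> N \<and>
    (\<exists>u u'. (u, u') \<in> A\<^sub>0 \<and> f = u + fst p \<and>
      (\<forall>b\<in>N. cinner (u' + \<i> *\<^sub>C u + \<i> *\<^sub>C fst p - snd p) b = 0))"

lemma boundary_valueE:
  assumes "boundary_value f (a, k)"
  obtains u u' where "a \<in> N" "k \<in> N" "(u, u') \<in> A\<^sub>0" "f = u + a"
    "\<And>b. b \<in> N \<Longrightarrow> cinner (u' + \<i> *\<^sub>C u + \<i> *\<^sub>C a - k) b = 0"
  using assms unfolding boundary_value_def fst_conv snd_conv by blast

lemma boundary_valueI:
  assumes "a \<in> N" "k \<in> N" "(u, u') \<in> A\<^sub>0" "f = u + a"
    "\<And>b. b \<in> N \<Longrightarrow> cinner (u' + \<i> *\<^sub>C u + \<i> *\<^sub>C a - k) b = 0"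
  shows "boundary_value f (a, k)"
  using assms unfolding boundary_value_def fst_conv snd_conv by blast

lemma boundary_value_add:
  assumes "boundary_value f p" "boundary_value g q"
  shows "boundary_value (f + g) (p + q)"
proof -
  obtain a k b l where pq: "p = (a, k)" "q = (b, l)"
    by (metis surj_pair)
  obtain u u' where u: "a \<in> N" "k \<in> N" "(u, u') \<in> A\<^sub>0" "f = u + a"
    "\<And>c. c \<in> N \<Longrightarrow> cinner (u' + \<i> *\<^sub>C u + \<i> *\<^sub>C a - k) c = 0"
    using boundary_valueE assms(1) unfolding pq by blast
  obtain v v' where v: "b \<in> N" "l \<in> N" "(v, v') \<in> A\<^sub>0" "g = v + b"
    "\<And>c. c \<in> N \<Longrightarrow> cinner (v' + \<i> *\<^sub>C v + \<i> *\<^sub>C b - l) c = 0"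
    using boundary_valueE assms(2) unfolding pq by blast
  have "boundary_value (f + g) (a + b, k + l)"
  proof (rule boundary_valueI)
    show "(u + v, u' + v') \<in> A\<^sub>0"
      using complex_vector.subspace_add[OF subspace_extension u(3) v(3)] by simp
    show "cinner (u' + v' + \<i> *\<^sub>C (u + v) + \<i> *\<^sub>C (a + b) - (k + l)) c = 0" if "c \<in> N" for c
    proof -
      have "u' + v' + \<i> *\<^sub>C (u + v) + \<i> *\<^sub>C (a + b) - (k + l) =
          (u' + \<i> *\<^sub>C u + \<i> *\<^sub>C a - k) + (v' + \<i> *\<^sub>C v + \<i> *\<^sub>C b - l)"
        by (simp add: scaleC_add_right)
      then show ?thesis
        using u(5)[OF that] v(5)[OF that] by (simp only: cinner_add_left add_0)
    qed
  qed (use u v complex_vector.subspace_add[OF subspace_N] in auto)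
  then show ?thesis
    by (simp add: pq)
qed

lemma boundary_value_scale:
  assumes "boundary_value f p"
  shows "boundary_value (c *\<^sub>C f) (c *\<^sub>C p)"
proof -
  obtain a k where p: "p = (a, k)"
    by (metis surj_pair)
  obtain u u' where u: "a \<in> N" "k \<in> N" "(u, u') \<in> A\<^sub>0" "f = u + a"
    "\<And>c. c \<in> N \<Longrightarrow> cinner (u' + \<i> *\<^sub>C u + \<i> *\<^sub>C a - k) c = 0"
    using boundary_valueE assms(1) unfolding p by blast
  have "boundary_value (c *\<^sub>C f) (c *\<^sub>C a, c *\<^sub>C k)"
  proof (rule boundary_valueI)
    show "(c *\<^sub>C u, c *\<^sub>C u') \<in> A\<^sub>0"
      using complex_vector.subspace_scale[OF subspace_extension u(3)] by simp
    show "cinner (c *\<^sub>C u' + \<i> *\<^sub>C (c *\<^sub>C u) + \<i> *\<^sub>C (c *\<^sub>C a) - c *\<^sub>C k) b = 0" if "b \<in> N" for b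
    proof -
      have "c *\<^sub>C u' + \<i> *\<^sub>C (c *\<^sub>C u) + \<i> *\<^sub>C (c *\<^sub>C a) - c *\<^sub>C k =
          c *\<^sub>C (u' + \<i> *\<^sub>C u + \<i> *\<^sub>C a - k)"
        by (simp add: scaleC_add_right complex_vector.scale_right_diff_distrib scaleC_scaleC
            mult.commute)
      then show ?thesis
        using u(5)[OF that] by (simp add: cinner_scaleC_left)
    qed
  qed (use u complex_vector.subspace_scale[OF subspace_N] in \<open>auto simp: scaleC_add_right\<close>)
  then show ?thesis
    by (simp add: p)
qed

text \<open>Here \<open>u = - a\<close> lies in both \<open>Domain A\<^sub>0\<close> and
  \<open>N\<close>, so it would be an eigenvector of a symmetric operator for the eigenvalue \<i>
  and must vanish. Then \<open>k\<close> is an element of \<open>N\<close> orthogonal to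
  \<open>N\<close>.\<close>

lemma boundary_value_0:
  assumes "boundary_value 0 p"
  shows "p = 0"
proof -
  obtain a k where p: "p = (a, k)"
    by (metis surj_pair)
  obtain u u' where u: "a \<in> N" "k \<in> N" "(u, u') \<in> A\<^sub>0" "0 = u + a"
    "\<And>c. c \<in> N \<Longrightarrow> cinner (u' + \<i> *\<^sub>C u + \<i> *\<^sub>C a - k) c = 0"
    using boundary_valueE assms(1) unfolding p by blast
  have "u = - a"
    using u(4) by (simp add: eq_neg_iff_add_eq_0)
  then have "u \<in> N"
    using complex_vector.subspace_neg[OF subspace_N u(1)] by simp
  then have "u' = \<i> *\<^sub>C u"
    using adjoint_unique extension_subset_adjoint u(3) by (auto simp: mem_N)
  then have "cinner u u = 0"
    using extension_symmetric[OF u(3) u(3)] by (simp add: cinner_simps)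
  then have "u = 0"
    by simp
  then have "a = 0" "u' = 0"
    using \<open>u = - a\<close> \<open>u' = \<i> *\<^sub>C u\<close> by auto
  then have "cinner k k = 0"
    using u(5)[OF u(2)] \<open>u = 0\<close> by simp
  then show ?thesis
    using \<open>a = 0\<close> p by (simp add: zero_prod_def)
qed

lemma boundary_value_unique:
  assumes "boundary_value f p" "boundary_value f q"
  shows "p = q"
  using boundary_value_0[of "p + (- 1) *\<^sub>C q"]
    boundary_value_add[OF assms(1) boundary_value_scale[OF assms(2), of "- 1"]]
  by (simp add: scaleC_one)

lemma boundary_value_extension:
  assumes "(u, u') \<in> A\<^sub>0" "a \<in> N"
  obtains k where "boundary_value (u + a) (a, k)"
proof -
  obtain k where k: "k \<in> N" "\<And>b. b \<in> N \<Longrightarrow> cinner (u' + \<i> *\<^sub>C u + \<i> *\<^sub>C a - k) b = 0"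
    using cinner_orthogonal_decomposition[OF subspace_N closed_N] by blast
  with that show thesis
    using boundary_valueI[OF assms(2) k(1) assms(1)] by blast
qed

text \<open>Von Neumann's decomposition: solve \<open>(A\<^sub>0 - \<i>) u = f' - \<i> f\<close>;
  the remainder \<open>f - u\<close> is then in the kernel \<open>N\<close>.\<close>

lemma boundary_value_exists:
  assumes "f \<in> Domain (adjoint_op A)"
  obtains a k where "boundary_value f (a, k)"
proof -
  obtain f' where f: "(f, f') \<in> adjoint_op A"
    using assms by blast
  obtain u u' where u: "(u, u') \<in> A\<^sub>0" "u' + (- \<i>) *\<^sub>C u = f' - \<i> *\<^sub>C f"
    by (rule selfadjoint_operator_range[OF selfadjoint, of "- \<i>" "f' - \<i> *\<^sub>C f"]) simp_all
  have "(f - u, f' - u') \<in> adjoint_op A"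
    using complex_vector.subspace_diff[OF subspace_adjoint_op f] u(1) extension_subset_adjoint
    by fastforce
  moreover have "f' - u' = \<i> *\<^sub>C (f - u)"
    using u(2) by (simp add: complex_vector.scale_right_diff_distrib algebra_simps)
  ultimately have "f - u \<in> N"
    by (simp add: mem_N)
  then obtain k where "boundary_value (u + (f - u)) (f - u, k)"
    by (rule boundary_value_extension[OF u(1)])
  with that show thesis
    by simp
qed

definition \<Gamma> :: "'h \<Rightarrow> 'h \<times> 'h"
  where "\<Gamma> f = (THE p. boundary_value f p)"

lemma \<Gamma>_eq: "boundary_value f p \<Longrightarrow> \<Gamma> f = p"
  unfolding \<Gamma>_def by (rule the_equality, assumption) (rule boundary_value_unique)

lemma boundary_value_\<Gamma>:
  assumes "f \<in> Domain (adjoint_op A)"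
  shows "boundary_value f (\<Gamma> f)"
proof -
  obtain a k where "boundary_value f (a, k)"
    using boundary_value_exists[OF assms] .
  then show ?thesis
    by (simp only: \<Gamma>_eq)
qed

text \<open>Tested against elements of \<open>N\<close>, the projections \<open>k\<close> and
  \<open>l\<close> may be replaced by the vectors they project. After expansion, the terms involving
  only \<open>u\<close> and \<open>v\<close> cancel by symmetry of \<open>A\<^sub>0\<close>.\<close>

lemma boundary_value_green:
  assumes "boundary_value f (a, k)" "boundary_value g (b, l)"
    and f: "(f, f') \<in> adjoint_op A" and g: "(g, g') \<in> adjoint_op A"
  shows "cinner f' g - cinner f g' = cinner k b - cinner a l"
proof -
  obtain u u' where u: "a \<in> N" "k \<in> N" "(u, u') \<in> A\<^sub>0" "f = u + a"
    "\<And>c. c \<in> N \<Longrightarrow> cinner (u' + \<i> *\<^sub>C u + \<i> *\<^sub>C a - k) c = 0"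
    using boundary_valueE[OF assms(1)] by blast
  obtain v v' where v: "b \<in> N" "l \<in> N" "(v, v') \<in> A\<^sub>0" "g = v + b"
    "\<And>c. c \<in> N \<Longrightarrow> cinner (v' + \<i> *\<^sub>C v + \<i> *\<^sub>C b - l) c = 0"
    using boundary_valueE[OF assms(2)] by blast
  have split: "(w + c, w' + \<i> *\<^sub>C c) \<in> adjoint_op A" if "(w, w') \<in> A\<^sub>0" "c \<in> N" for w w' c
    using that extension_subset_adjoint
      complex_vector.subspace_add[OF subspace_adjoint_op, of "(w, w')" A "(c, \<i> *\<^sub>C c)"]
    by (auto simp: mem_N)
  have f': "f' = u' + \<i> *\<^sub>C a" and g': "g' = v' + \<i> *\<^sub>C b"
    using f g split[OF u(3,1)] split[OF v(3,1)] adjoint_unique unfolding u(4) v(4) by blast+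
  have k: "cinner k b = cinner (u' + \<i> *\<^sub>C u + \<i> *\<^sub>C a) b"
    using u(5)[OF v(1)] by (simp add: cinner_diff_left)
  have "cinner (v' + \<i> *\<^sub>C v + \<i> *\<^sub>C b - l) a = 0"
    by (rule v(5)[OF u(1)])
  then have "cinner a (v' + \<i> *\<^sub>C v + \<i> *\<^sub>C b - l) = 0"
    by (rule cinner_eq_0_commute[THEN iffD1])
  then have l: "cinner a l = cinner a (v' + \<i> *\<^sub>C v + \<i> *\<^sub>C b)"
    by (simp add: cinner_diff_right)
  show ?thesis
    unfolding k l f' g' u(4) v(4) using extension_symmetric[OF u(3) v(3)]
    by (simp add: cinner_simps algebra_simps)
qed

lemma boundary_value_onto:
  assumes "a \<in> N" "k \<in> N"
  obtains f where "f \<in> Domain (adjoint_op A)" "boundary_value f (a, k)"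
proof -
  \<comment> \<open>With this right-hand side the vector to be projected is exactly
    \<open>k\<close>, which already lies in \<open>N\<close>.\<close>
  obtain u u' where u: "(u, u') \<in> A\<^sub>0" "u' + \<i> *\<^sub>C u = k - \<i> *\<^sub>C a"
    by (rule selfadjoint_operator_range[OF selfadjoint, of \<i> "k - \<i> *\<^sub>C a"]) simp_all
  have "u \<in> Domain (adjoint_op A)" "a \<in> Domain (adjoint_op A)"
    using u(1) extension_subset_adjoint assms(1) by (auto simp: mem_N)
  then have "u + a \<in> Domain (adjoint_op A)"
    by (rule complex_vector.subspace_add[OF subspace_Domain_adjoint])
  moreover have "boundary_value (u + a) (a, k)"
    using u by (intro boundary_valueI[OF assms u(1)]) auto
  ultimately show thesis
    by (rule that)
qed

theorem boundary_triplet: "boundary_triplet A N (fst \<circ> \<Gamma>) (snd \<circ> \<Gamma>)"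
proof -
  have add: "\<Gamma> (f + g) = \<Gamma> f + \<Gamma> g"
    if "f \<in> Domain (adjoint_op A)" "g \<in> Domain (adjoint_op A)" for f g
    by (intro \<Gamma>_eq boundary_value_add boundary_value_\<Gamma> that)
  have scale: "\<Gamma> (c *\<^sub>C f) = c *\<^sub>C \<Gamma> f" if "f \<in> Domain (adjoint_op A)" for c f
    by (intro \<Gamma>_eq boundary_value_scale boundary_value_\<Gamma> that)
  have "clinear_on (Domain (adjoint_op A)) (fst \<circ> \<Gamma>)" "clinear_on (Domain (adjoint_op A)) (snd \<circ> \<Gamma>)"
    unfolding clinear_on_def by (simp_all add: add scale scaleC_prod_def)
  moreover have "cinner f' g - cinner f g' =
      cinner (snd (\<Gamma> f)) (fst (\<Gamma> g)) - cinner (fst (\<Gamma> f)) (snd (\<Gamma> g))"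
    if "(f, f') \<in> adjoint_op A" "(g, g') \<in> adjoint_op A" for f f' g g'
    using that by (intro boundary_value_green) (simp_all add: boundary_value_\<Gamma> DomainI)
  moreover have "(\<lambda>f. (snd (\<Gamma> f), fst (\<Gamma> f))) ` Domain (adjoint_op A) = N \<times> N"
  proof (intro equalityI subsetI)
    fix q assume "q \<in> (\<lambda>f. (snd (\<Gamma> f), fst (\<Gamma> f))) ` Domain (adjoint_op A)"
    then obtain f where "f \<in> Domain (adjoint_op A)" "q = (snd (\<Gamma> f), fst (\<Gamma> f))"
      by blast
    then show "q \<in> N \<times> N"
      using boundary_value_\<Gamma>[of f] by (simp add: boundary_value_def)
  next
    fix q assume "q \<in> N \<times> N"
    then have "snd q \<in> N" "fst q \<in> N"
      by auto
    then obtain f where "f \<in> Domain (adjoint_op A)" "boundary_value f (snd q, fst q)"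
      by (rule boundary_value_onto)
    then show "q \<in> (\<lambda>f. (snd (\<Gamma> f), fst (\<Gamma> f))) ` Domain (adjoint_op A)"
      using \<Gamma>_eq by (intro image_eqI[of _ _ f]) auto
  qed
  ultimately show ?thesis
    unfolding boundary_triplet_def using subspace_N closed_N by (simp add: split_beta)
qed

lemma kernel_eq_Domain: "{f \<in> Domain (adjoint_op A). (fst \<circ> \<Gamma>) f = 0} = Domain A\<^sub>0"
proof (intro equalityI subsetI)
  fix f assume "f \<in> {f \<in> Domain (adjoint_op A). (fst \<circ> \<Gamma>) f = 0}"
  then have "boundary_value f (0, snd (\<Gamma> f))"
    using boundary_value_\<Gamma>[of f] by (metis (mono_tags) comp_apply mem_Collect_eq prod.collapse)
  then show "f \<in> Domain A\<^sub>0"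
    by (elim boundary_valueE) auto
next
  fix f assume f: "f \<in> Domain A\<^sub>0"
  then obtain f' where "(f, f') \<in> A\<^sub>0"
    by blast
  then obtain k where "boundary_value (f + 0) (0, k)"
    using boundary_value_extension complex_vector.subspace_0[OF subspace_N] by blast
  then have "fst (\<Gamma> f) = 0"
    using \<Gamma>_eq by fastforce
  with f show "f \<in> {f \<in> Domain (adjoint_op A). (fst \<circ> \<Gamma>) f = 0}"
    using extension_subset_adjoint by auto
qed

end

section \<open>Almost solvability and transversality\<close>

context closed_symmetric
begin

text \<open>The type \<open>'k\<close> is arbitrary here, which allows a boundary space in any
  Hilbert space type to be exchanged for one in \<open>'h\<close> by passing through
  transversality.\<close>

lemma almost_solvable_imp_transversal:
  assumes "almost_solvable TYPE('k::chilbert_space) A At"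
  obtains A\<^sub>0 where "selfadjoint_operator A\<^sub>0" "A \<subseteq> A\<^sub>0" "transversal A At A\<^sub>0"
proof -
  obtain H :: "'k set" and \<Gamma>\<^sub>0 \<Gamma>\<^sub>1 B
    where bt: "boundary_triplet A H \<Gamma>\<^sub>0 \<Gamma>\<^sub>1" and At: "proper_extension A At" "bounded_operator_on H B"
      "Domain At = {f \<in> Domain (adjoint_op A). \<Gamma>\<^sub>1 f = B (\<Gamma>\<^sub>0 f)}"
    using assms unfolding almost_solvable_def by blast
  interpret symmetric_triplet A H \<Gamma>\<^sub>0 \<Gamma>\<^sub>1
    by unfold_locales (rule bt)
  show thesis
    using that selfadjoint_kernel_extension subset_kernel_extension transversal_kernel_extension[OF At]
    by blast
qed

text \<open>The triplet built on the deficiency space \<open>E.N\<close> has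
  \<open>A\<^sub>0\<close> as its kernel extension, so \<open>bounded_parameter\<close> supplies
  \<open>B\<close>.\<close>

lemma transversal_imp_almost_solvable:
  assumes "selfadjoint_operator A\<^sub>0" "A \<subseteq> A\<^sub>0" "transversal A At A\<^sub>0" "closed At"
  shows "almost_solvable TYPE('h) A At"
proof -
  interpret E: selfadjoint_extension A A\<^sub>0
    by unfold_locales (use assms in auto)
  interpret symmetric_triplet A E.N "fst \<circ> E.\<Gamma>" "snd \<circ> E.\<Gamma>"
    by unfold_locales (rule E.boundary_triplet)
  show ?thesis
    unfolding almost_solvable_def
    using assms(3) E.boundary_triplet bounded_parameter[OF assms(4,3) E.kernel_eq_Domain]
    unfolding transversal_def by blast
qed

end

text \<open>The middle conjunct shows that fixing \<open>'h\<close> as the ambient space of the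
  boundary spaces loses no almost solvable extension; the last one treats triplets over any Hilbert
  space type \<open>'k\<close>.\<close>

theorem proposition2p4:
  fixes A At :: "'h::chilbert_space operator"
  assumes "separable_space (euclidean :: 'h topology)"
    and "linear_operator A"
    and "closed A"
    and "densely_defined A"
    and "symmetric_operator A"
    and "equal_deficiency_indices A"
    and "proper_extension A At"
    and "closed At"
  shows "(almost_solvable TYPE('h) A At \<longleftrightarrow>
      (\<exists>A\<^sub>0. selfadjoint_operator A\<^sub>0 \<and> A \<subseteq> A\<^sub>0 \<and> transversal A At A\<^sub>0)) \<and>
    (almost_solvable TYPE('k::chilbert_space) A At \<longrightarrow> almost_solvable TYPE('h) A At) \<and>
    (\<forall>A\<^sub>0. selfadjoint_operator A\<^sub>0 \<and> A \<subseteq> A\<^sub>0 \<and> transversal A At A\<^sub>0 \<longrightarrow>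
      (\<forall>(H :: 'k set) \<Gamma>\<^sub>0 \<Gamma>\<^sub>1. boundary_triplet A H \<Gamma>\<^sub>0 \<Gamma>\<^sub>1 \<and>
          {f \<in> Domain (adjoint_op A). \<Gamma>\<^sub>0 f = 0} = Domain A\<^sub>0 \<longrightarrow>
        (\<exists>B. bounded_operator_on H B \<and>
          Domain At = {f \<in> Domain (adjoint_op A). \<Gamma>\<^sub>1 f = B (\<Gamma>\<^sub>0 f)})))"
proof -
  interpret closed_symmetric A
    by unfold_locales (fact assms)+
  have bounded: "\<exists>B. bounded_operator_on H B \<and>
      Domain At = {f \<in> Domain (adjoint_op A). \<Gamma>\<^sub>1 f = B (\<Gamma>\<^sub>0 f)}"
    if "transversal A At A\<^sub>0" "boundary_triplet A H \<Gamma>\<^sub>0 \<Gamma>\<^sub>1"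
      "{f \<in> Domain (adjoint_op A). \<Gamma>\<^sub>0 f = 0} = Domain A\<^sub>0" for A\<^sub>0 \<Gamma>\<^sub>0 \<Gamma>\<^sub>1 and H :: "'k set"
  proof -
    interpret symmetric_triplet A H \<Gamma>\<^sub>0 \<Gamma>\<^sub>1
      by unfold_locales (rule that(2))
    show ?thesis
      by (rule bounded_parameter[OF assms(8) that(1,3)])
  qed
  have iff: "almost_solvable TYPE('h) A At \<longleftrightarrow>
      (\<exists>A\<^sub>0. selfadjoint_operator A\<^sub>0 \<and> A \<subseteq> A\<^sub>0 \<and> transversal A At A\<^sub>0)"
    using almost_solvable_imp_transversal[of At, where ?'k = 'h]
      transversal_imp_almost_solvable[OF _ _ _ assms(8)] by blast
  moreover have "almost_solvable TYPE('h) A At" if "almost_solvable TYPE('k) A At"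
    using almost_solvable_imp_transversal[OF that] iff by blast
  ultimately show ?thesis
    using bounded by blast
qed

end
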